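(* Consider an $\mathcal{FS}$-space with metric function $F=bV(x,w)$ ($b>0$), and scalars $C(x),C_1(x)$ with $C>0$, $C>|C_1|$, $H=\sqrt{C^2-C_1^2}$. The transformation $$t^m=\left[i^m\sin\varrho+\frac1{2\breve k}\left(1-\breve k^2+(1+\breve k^2)\cos\varrho\right)\widetilde b^m\right]\frac{H}{\sqrt\mu}F^H$$ entails, for a suitable scalar $\varrho=\varrho(x,w)$, a conformal automorphism of degree $H$ of $(M,F)$ to $(M,S)$ if and only if $H\le1$ and $$\tau=\breve C^2+2\breve C\sqrt{1-H^2}\;\widetilde w+\widetilde w^2$$ for some scalar $\breve C=\breve C(x)$.
   Context: $(M,S)$ is a Riemannian space of dimension $N\ge3$, $S(x,y)=\sqrt{a_{ij}(x)y^iy^j}$, and $b=b_i(x)y^i$ is a non-vanishing 1-form whose Riemannian norm $c=c(x)=\sqrt{a^{ij}b_ib_j}$ satisfies $0<c<1$. Put $b^i=a^{ij}b_j$, $\widetilde b_i=b_i/c$, $\widetilde b^i=b^i/c$, $$q=\sqrt{a_{ij}y^iy^j-b^2},\quad w=\frac qb,\quad \widetilde q=\sqrt{q^2+\left(1-\tfrac1{c^2}\right)b^2},\quad \widetilde w=\frac{\widetilde q}{b},\quad i^m=\left(y^m-\tfrac1{c^2}b\,b^m\right)\frac1{\widetilde q}.$$ Everything is considered locally, in the domain $b>0$, $\widetilde q>0$. An $\mathcal{FS}$-space has a Finsler metric function $F$ depending on $x$, $b$ and $S$ only, written as $F=bV(x,w)$ (equivalently $F=b\widetilde V(x,\widetilde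 w)$); $\tau=wV/(\partial V/\partial w)=\widetilde w\widetilde V/(\partial\widetilde V/\partial\widetilde w)$. Also $$\breve k=\sqrt{\frac{C-C_1}{C+C_1}},\qquad \sqrt\mu=\frac{H}{2\breve k}\left[1+\breve k^2+(1-\breve k^2)\cos\varrho\right]=C+C_1\cos\varrho,\qquad \varrho\in(0,\pi).$$ A Finsler metric function is smooth, positive, positively 1-homogeneous in $y$, with positive-definite $g_{ij}=\frac12\,\partial^2F^2/\partial y^i\partial y^j$. A transformation $t=t(x,y)$ (locally invertible in $y$, $x$ fixed) realizes a conformal automorphism of degree $H$ of $(M,F)$ to $(M,S)$ if $t^m(x,ky)=k^Ht^m(x,y)$ for $k>0$; $F(x,y)=1\iff S(x,t(x,y))=1$; and $g_{mn}(x,y)=p^2a_{ij}(x)t^i_mt^j_n$ with $t^i_m=\partial t^i/\partial y^m$, $p=\frac1HF^{1-H}$. *)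

theory Defs
  imports "HOL-Analysis.Analysis"
begin

text \<open>
  Everything lives in a coordinate chart: \<open>x\<close> ranges over an open \<open>U \<subseteq> \<real>\<^sup>N\<close>, with
  \<open>N = CARD('n)\<close>, and tangent vectors \<open>y\<close> over \<open>\<real>\<^sup>N\<close>. Arguments: \<open>a x\<close> is the matrix
  \<open>a\<^sub>i\<^sub>j(x)\<close>, \<open>\<beta> x\<close> the component vector \<open>b\<^sub>i(x)\<close>.
\<close>

section \<open>Smooth maps\<close>

text \<open>Only meant for open sets: \<open>C\<^sup>k\<close>, by iterating directional derivatives.\<close>

fun Ck_on :: "nat \<Rightarrow> ('a::real_normed_vector \<Rightarrow> 'b::real_normed_vector) \<Rightarrow> 'a set \<Rightarrow> bool" where
  "Ck_on 0 f S \<longleftrightarrow> continuous_on S f"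
| "Ck_on (Suc k) f S \<longleftrightarrow>
     (\<forall>x\<in>S. f differentiable (at x)) \<and> (\<forall>v. Ck_on k (\<lambda>x. frechet_derivative f (at x) v) S)"

definition smooth_on :: "('a::real_normed_vector \<Rightarrow> 'b::real_normed_vector) \<Rightarrow> 'a set \<Rightarrow> bool" where
  "smooth_on f S \<longleftrightarrow> (\<forall>k. Ck_on k f S)"

definition partial :: "(real^'n \<Rightarrow> real) \<Rightarrow> 'n \<Rightarrow> real^'n \<Rightarrow> real" where
  "partial f m y = frechet_derivative f (at y) (axis m 1)"

definition locally_invertible_on ::
    "('a::topological_space \<Rightarrow> 'b::topological_space) \<Rightarrow> 'a set \<Rightarrow> bool" where
  "locally_invertible_on f S \<longleftrightarrow>
     (\<forall>y\<in>S. \<exists>A g. open A \<and> y \<in> A \<and> A \<subseteq> S \<and> open (f ` A) \<and> homeomorphism A (f ` A) f g)"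

section \<open>The Riemannian metric and the 1-form\<close>

definition riemannian_metric_on :: "(real^'n) set \<Rightarrow> (real^'n \<Rightarrow> real^'n^'n) \<Rightarrow> bool" where
  "riemannian_metric_on U a \<longleftrightarrow>
     smooth_on a U \<and>
     (\<forall>x\<in>U. transpose (a x) = a x \<and> (\<forall>v. v \<noteq> 0 \<longrightarrow> v \<bullet> (a x *v v) > 0))"

definition riem_norm :: "(real^'n \<Rightarrow> real^'n^'n) \<Rightarrow> real^'n \<Rightarrow> real^'n \<Rightarrow> real" where
  "riem_norm a x y = sqrt (y \<bullet> (a x *v y))"

definition one_form :: "(real^'n \<Rightarrow> real^'n) \<Rightarrow> real^'n \<Rightarrow> real^'n \<Rightarrow> real" where
  "one_form \<beta> x y = \<beta> x \<bullet> y"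

definition b_up :: "(real^'n \<Rightarrow> real^'n^'n) \<Rightarrow> (real^'n \<Rightarrow> real^'n) \<Rightarrow> real^'n \<Rightarrow> real^'n" where
  "b_up a \<beta> x = matrix_inv (a x) *v \<beta> x"

definition c_norm :: "(real^'n \<Rightarrow> real^'n^'n) \<Rightarrow> (real^'n \<Rightarrow> real^'n) \<Rightarrow> real^'n \<Rightarrow> real" where
  "c_norm a \<beta> x = sqrt (\<beta> x \<bullet> b_up a \<beta> x)"

definition b_up_unit :: "(real^'n \<Rightarrow> real^'n^'n) \<Rightarrow> (real^'n \<Rightarrow> real^'n) \<Rightarrow> real^'n \<Rightarrow> real^'n" where
  "b_up_unit a \<beta> x = (1 / c_norm a \<beta> x) *\<^sub>R b_up a \<beta> x"

definition q_fun :: "(real^'n \<Rightarrow> real^'n^'n) \<Rightarrow> (real^'n \<Rightarrow> real^'n) \<Rightarrow> real^'n \<Rightarrow> real^'n \<Rightarrow> real" where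
  "q_fun a \<beta> x y = sqrt (y \<bullet> (a x *v y) - (one_form \<beta> x y)\<^sup>2)"

definition w_fun :: "(real^'n \<Rightarrow> real^'n^'n) \<Rightarrow> (real^'n \<Rightarrow> real^'n) \<Rightarrow> real^'n \<Rightarrow> real^'n \<Rightarrow> real" where
  "w_fun a \<beta> x y = q_fun a \<beta> x y / one_form \<beta> x y"

definition qt_fun :: "(real^'n \<Rightarrow> real^'n^'n) \<Rightarrow> (real^'n \<Rightarrow> real^'n) \<Rightarrow> real^'n \<Rightarrow> real^'n \<Rightarrow> real" where
  "qt_fun a \<beta> x y =
     sqrt ((q_fun a \<beta> x y)\<^sup>2 + (1 - 1 / (c_norm a \<beta> x)\<^sup>2) * (one_form \<beta> x y)\<^sup>2)"

definition wt_fun :: "(real^'n \<Rightarrow> real^'n^'n) \<Rightarrow> (real^'n \<Rightarrow> real^'n) \<Rightarrow> real^'n \<Rightarrow> real^'n \<Rightarrow> real" where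
  "wt_fun a \<beta> x y = qt_fun a \<beta> x y / one_form \<beta> x y"

definition i_vec :: "(real^'n \<Rightarrow> real^'n^'n) \<Rightarrow> (real^'n \<Rightarrow> real^'n) \<Rightarrow> real^'n \<Rightarrow> real^'n \<Rightarrow> real^'n" where
  "i_vec a \<beta> x y =
     (1 / qt_fun a \<beta> x y) *\<^sub>R (y - (one_form \<beta> x y / (c_norm a \<beta> x)\<^sup>2) *\<^sub>R b_up a \<beta> x)"

section \<open>FS-spaces\<close>

definition max_domain ::
    "(real^'n) set \<Rightarrow> (real^'n \<Rightarrow> real^'n^'n) \<Rightarrow> (real^'n \<Rightarrow> real^'n) \<Rightarrow> ((real^'n) \<times> (real^'n)) set" where
  "max_domain U a \<beta> = {(x, y). x \<in> U \<and> one_form \<beta> x y > 0 \<and> qt_fun a \<beta> x y > 0}"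

text \<open>
  The local domain of \<open>V(x,w)\<close>: an open set \<open>W\<close> of values \<open>(x,w)\<close> attained where
  \<open>b > 0\<close> and \<open>q\<^sub>t > 0\<close>, such that over each \<open>x \<in> U\<close> the variable \<open>w\<close> runs through a (nonempty)
  interval. The whole set of attained values is the largest possible choice.
\<close>

definition w_domain ::
    "(real^'n) set \<Rightarrow> (real^'n \<Rightarrow> real^'n^'n) \<Rightarrow> (real^'n \<Rightarrow> real^'n) \<Rightarrow> ((real^'n) \<times> real) set \<Rightarrow> bool" where
  "w_domain U a \<beta> W \<longleftrightarrow>
     open W \<and> W \<subseteq> (\<lambda>(x, y). (x, w_fun a \<beta> x y)) ` max_domain U a \<beta> \<and>
     (\<forall>x\<in>U. {w. (x, w) \<in> W} \<noteq> {} \<and> connected {w. (x, w) \<in> W})"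

definition fs_domain ::
    "(real^'n) set \<Rightarrow> (real^'n \<Rightarrow> real^'n^'n) \<Rightarrow> (real^'n \<Rightarrow> real^'n) \<Rightarrow> ((real^'n) \<times> real) set
      \<Rightarrow> ((real^'n) \<times> (real^'n)) set" where
  "fs_domain U a \<beta> W = {(x, y). (x, y) \<in> max_domain U a \<beta> \<and> (x, w_fun a \<beta> x y) \<in> W}"

definition fundamental_tensor :: "(real^'n \<Rightarrow> real^'n \<Rightarrow> real) \<Rightarrow> real^'n \<Rightarrow> real^'n \<Rightarrow> real^'n^'n" where
  "fundamental_tensor F x y =
     (\<chi> m n. 1/2 * partial (partial (\<lambda>z. (F x z)\<^sup>2) n) m y)"

definition finsler_metric_on ::
    "((real^'n) \<times> (real^'n)) set \<Rightarrow> (real^'n \<Rightarrow> real^'n \<Rightarrow> real) \<Rightarrow> bool" where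
  "finsler_metric_on D F \<longleftrightarrow>
     smooth_on (\<lambda>(x, y). F x y) D \<and>
     (\<forall>(x, y)\<in>D. F x y > 0 \<and> (\<forall>k>0. F x (k *\<^sub>R y) = k * F x y) \<and>
        (\<forall>v. v \<noteq> 0 \<longrightarrow> v \<bullet> (fundamental_tensor F x y *v v) > 0))"

definition fs_metric ::
    "(real^'n \<Rightarrow> real^'n^'n) \<Rightarrow> (real^'n \<Rightarrow> real^'n) \<Rightarrow> (real^'n \<Rightarrow> real \<Rightarrow> real)
      \<Rightarrow> real^'n \<Rightarrow> real^'n \<Rightarrow> real" where
  "fs_metric a \<beta> V x y = one_form \<beta> x y * V x (w_fun a \<beta> x y)"

definition fs_space ::
    "(real^'n) set \<Rightarrow> (real^'n \<Rightarrow> real^'n^'n) \<Rightarrow> (real^'n \<Rightarrow> real^'n) \<Rightarrow> ((real^'n) \<times> real) set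
      \<Rightarrow> (real^'n \<Rightarrow> real \<Rightarrow> real) \<Rightarrow> bool" where
  "fs_space U a \<beta> W V \<longleftrightarrow>
     open U \<and> riemannian_metric_on U a \<and> smooth_on \<beta> U \<and>
     (\<forall>x\<in>U. 0 < c_norm a \<beta> x \<and> c_norm a \<beta> x < 1) \<and>
     w_domain U a \<beta> W \<and> smooth_on (\<lambda>(x, w). V x w) W \<and>
     finsler_metric_on (fs_domain U a \<beta> W) (fs_metric a \<beta> V)"

text \<open>
  On an FS-space \<open>\<partial>V/\<partial>w > 0\<close> by positive-definiteness, so the quotient is never a division by zero.
\<close>

definition tau :: "(real^'n \<Rightarrow> real \<Rightarrow> real) \<Rightarrow> real^'n \<Rightarrow> real \<Rightarrow> real" where
  "tau V x w = w * V x w / deriv (V x) w"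

section \<open>Conformal automorphisms\<close>

text \<open>The degree \<open>H\<close> is a scalar field, as it is allowed to depend on \<open>x\<close>.\<close>

definition conformal_automorphism ::
    "((real^'n) \<times> (real^'n)) set \<Rightarrow> (real^'n \<Rightarrow> real^'n^'n) \<Rightarrow> (real^'n \<Rightarrow> real^'n \<Rightarrow> real)
      \<Rightarrow> (real^'n \<Rightarrow> real) \<Rightarrow> (real^'n \<Rightarrow> real^'n \<Rightarrow> real^'n) \<Rightarrow> bool" where
  "conformal_automorphism D a F H t \<longleftrightarrow>
     smooth_on (\<lambda>(x, y). t x y) D \<and>
     (\<forall>x. locally_invertible_on (t x) {y. (x, y) \<in> D}) \<and>
     (\<forall>(x, y)\<in>D.
        (\<forall>k>0. t x (k *\<^sub>R y) = (k powr H x) *\<^sub>R t x y) \<and>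
        (F x y = 1 \<longleftrightarrow> riem_norm a x (t x y) = 1) \<and>
        (let p = 1 / H x * F x y powr (1 - H x); J = jacobian (t x) (at y) in
          \<forall>m n. fundamental_tensor F x y $ m $ n =
            p\<^sup>2 * (\<Sum>i\<in>UNIV. \<Sum>j\<in>UNIV. a x $ i $ j * J $ i $ m * J $ j $ n)))"

definition H_deg :: "(real^'n \<Rightarrow> real) \<Rightarrow> (real^'n \<Rightarrow> real) \<Rightarrow> real^'n \<Rightarrow> real" where
  "H_deg C C1 x = sqrt ((C x)\<^sup>2 - (C1 x)\<^sup>2)"

definition k_breve :: "(real^'n \<Rightarrow> real) \<Rightarrow> (real^'n \<Rightarrow> real) \<Rightarrow> real^'n \<Rightarrow> real" where
  "k_breve C C1 x = sqrt ((C x - C1 x) / (C x + C1 x))"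

definition sqrt_mu :: "(real^'n \<Rightarrow> real) \<Rightarrow> (real^'n \<Rightarrow> real) \<Rightarrow> real^'n \<Rightarrow> real \<Rightarrow> real" where
  "sqrt_mu C C1 x r =
     H_deg C C1 x / (2 * k_breve C C1 x) *
       (1 + (k_breve C C1 x)\<^sup>2 + (1 - (k_breve C C1 x)\<^sup>2) * cos r)"

lemma sqrt_mu_eq:
  assumes "C x > \<bar>C1 x\<bar>"
  shows "sqrt_mu C C1 x r = C x + C1 x * cos r"
proof -
  define s where "s = C x + C1 x"
  define d where "d = C x - C1 x"
  have s: "s > 0" and d: "d > 0"
    using assms by (auto simp: s_def d_def)
  have H: "H_deg C C1 x = sqrt s * sqrt d"
    by (simp add: H_deg_def s_def d_def power2_eq_square algebra_simps flip: real_sqrt_mult)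
  have k: "k_breve C C1 x = sqrt d / sqrt s"
    by (simp add: k_breve_def s_def d_def real_sqrt_divide)
  have "H_deg C C1 x / (2 * k_breve C C1 x) = s / 2"
    using s d by (simp add: H k field_simps)
  moreover have "(k_breve C C1 x)\<^sup>2 = d / s"
    using s d by (simp add: k power_divide)
  ultimately have "sqrt_mu C C1 x r = s / 2 * (1 + d / s + (1 - d / s) * cos r)"
    by (simp only: sqrt_mu_def)
  also have "\<dots> = (s + d) / 2 + (s - d) / 2 * cos r"
    using s by (simp add: field_simps)
  finally show ?thesis
    by (simp add: s_def d_def)
qed

definition t_map ::
    "(real^'n \<Rightarrow> real^'n^'n) \<Rightarrow> (real^'n \<Rightarrow> real^'n) \<Rightarrow> (real^'n \<Rightarrow> real \<Rightarrow> real)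
      \<Rightarrow> (real^'n \<Rightarrow> real) \<Rightarrow> (real^'n \<Rightarrow> real) \<Rightarrow> (real^'n \<Rightarrow> real \<Rightarrow> real)
      \<Rightarrow> real^'n \<Rightarrow> real^'n \<Rightarrow> real^'n" where
  "t_map a \<beta> V C C1 \<rho> x y =
     (let r = \<rho> x (w_fun a \<beta> x y); k = k_breve C C1 x; H = H_deg C C1 x in
       (H / sqrt_mu C C1 x r * fs_metric a \<beta> V x y powr H) *\<^sub>R
         (sin r *\<^sub>R i_vec a \<beta> x y
          + (1 / (2 * k) * (1 - k\<^sup>2 + (1 + k\<^sup>2) * cos r)) *\<^sub>R b_up_unit a \<beta> x))"

end

theory Submission
  imports Defs
begin

text \<open>
  Fix \<open>x\<close>, write \<open>\<langle>\<cdot>,\<cdot>\<rangle>\<close> for the inner product given by \<open>a\<close>, \<open>e\<close> for the unit vector along \<open>b\<^sup>i\<close>, and \<open>u\<close>, \<open>r\<close>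
  for the tilded variables \<open>w\<close>, \<open>q\<close>, so that \<open>F = b \<Phi>(u)\<close>. The transformation is
  \<open>t = F\<^sup>H (\<sigma> i + \<kappa> e)\<close> with \<open>\<sigma>\<^sup>2 + \<kappa>\<^sup>2 = 1\<close>: a Moebius change of the angle \<open>\<rho>\<close> turns it into polar
  coordinates. With \<open>K\<close> the metric of the sphere of directions \<open>i\<close>, both sides of the conformality
  equation are sums of \<open>dF\<^sup>2\<close>, \<open>du\<^sup>2\<close> and \<open>K\<close>; comparing coefficients (this needs \<open>N \<ge> 3\<close> for \<open>K\<close>) gives
  \<open>H\<^sup>2 \<Phi>'' = \<Phi> (\<sigma>'\<^sup>2 + \<kappa>'\<^sup>2)\<close> and \<open>H\<^sup>2 u \<Phi>' = \<Phi> \<sigma>\<^sup>2\<close>.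
  Eliminating \<open>\<Phi>\<close> leaves \<open>((u \<kappa> / \<sigma>)')\<^sup>2 = H\<^sup>-\<^sup>2 - 1\<close>. Hence \<open>H \<le> 1\<close>, \<open>u \<kappa> / \<sigma>\<close> is affine in \<open>u\<close>, and
  \<open>\<tau> = H\<^sup>2 u\<^sup>2 / \<sigma>\<^sup>2\<close> is the required quadratic. Conversely the quadratic determines the cotangent
  \<open>\<kappa> / \<sigma>\<close> up to sign; it has to be expressed through \<open>\<tau>\<close> and its derivative in order to be
  smooth in \<open>x\<close>, since the scalar in the quadratic and the square root of \<open>1 - H\<^sup>2\<close> need not be.
\<close>

section \<open>Calculus of smooth maps\<close>

text \<open>On an open set, agreement on \<open>S\<close> is agreement near each of its points, so
  it passes to the directional derivatives, and the induction continues with these.\<close>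

lemma Ck_on_cong:
  assumes "open S" "\<And>x. x \<in> S \<Longrightarrow> f x = g x" "Ck_on k f S"
  shows "Ck_on k g S"
  using assms(2,3)
proof (induction k arbitrary: f g)
  case 0
  then show ?case using continuous_on_cong[of S S f g] by simp
next
  case (Suc k)
  have d: "(g has_derivative frechet_derivative f (at x)) (at x)" if "x \<in> S" for x
  proof -
    have "(f has_derivative frechet_derivative f (at x)) (at x)"
      using Suc.prems(2) that by (simp add: frechet_derivative_works)
    then show ?thesis
      using has_derivative_transform_within_open[of f _ x UNIV S g] \<open>open S\<close> that Suc.prems(1)
      by auto
  qed
  have e: "frechet_derivative f (at x) = frechet_derivative g (at x)" if "x \<in> S" for x
    using d[OF that] frechet_derivative_at by blast
  have "Ck_on k (\<lambda>x. frechet_derivative g (at x) v) S" for v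
    by (rule Suc.IH[of "\<lambda>x. frechet_derivative f (at x) v"]) (use Suc.prems(2) e in auto)
  then show ?case using d by (auto simp: differentiable_def)
qed

text \<open>Lets an explicitly known derivative \<open>f'\<close> stand in for the choice-based
  \<open>frechet_derivative\<close>; the two coincide by uniqueness of derivatives.\<close>

lemma Ck_on_SucI:
  assumes "open S" "\<And>x. x \<in> S \<Longrightarrow> (f has_derivative f' x) (at x)" "\<And>v. Ck_on k (\<lambda>x. f' x v) S"
  shows "Ck_on (Suc k) f S"
proof -
  have "Ck_on k (\<lambda>x. frechet_derivative f (at x) v) S" for v
    by (rule Ck_on_cong[OF assms(1) _ assms(3)[of v]]) (use assms(2) frechet_derivative_at in metis)
  then show ?thesis using assms(2) by (auto simp: differentiable_def)
qed

lemma Ck_on_SucD: "Ck_on (Suc k) f S \<Longrightarrow> Ck_on k f S"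
proof (induction k arbitrary: f)
  case 0
  then show ?case
    by (auto simp: continuous_on_eq_continuous_at intro!: differentiable_imp_continuous_on differentiable_at_imp_differentiable_on)
next
  case (Suc k)
  then show ?case by (metis Ck_on.simps(2))
qed

lemma Ck_on_differentiable: "Ck_on (Suc k) f S \<Longrightarrow> x \<in> S \<Longrightarrow> (f has_derivative frechet_derivative f (at x)) (at x)"
  by (simp add: frechet_derivative_works)

lemma Ck_on_const: "open S \<Longrightarrow> Ck_on k (\<lambda>x. c) S"
  by (induction k arbitrary: c) (auto simp: )

lemma Ck_on_bounded_linear_comp:
  assumes "bounded_linear h" "open S" "Ck_on k f S"
  shows "Ck_on k (\<lambda>x. h (f x)) S"
  using assms(3)
proof (induction k arbitrary: f)
  case 0
  then show ?case using assms by (simp add: bounded_linear.continuous_on)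
next
  case (Suc k)
  show ?case
  proof (rule Ck_on_SucI[OF assms(2)])
    show "((\<lambda>x. h (f x)) has_derivative (\<lambda>v. h (frechet_derivative f (at x) v))) (at x)" if "x \<in> S" for x
      using Ck_on_differentiable[OF Suc.prems that] by (rule bounded_linear.has_derivative[OF assms(1)])
    show "Ck_on k (\<lambda>x. h (frechet_derivative f (at x) v)) S" for v
      using Suc by simp
  qed
qed

lemma Ck_on_add:
  assumes "open S" "Ck_on k f S" "Ck_on k g S"
  shows "Ck_on k (\<lambda>x. f x + g x) S"
  using assms(2,3)
proof (induction k arbitrary: f g)
  case 0
  then show ?case by (simp add: continuous_on_add)
next
  case (Suc k)
  show ?case
    by (rule Ck_on_SucI[OF assms(1) has_derivative_add[OF Ck_on_differentiable[OF Suc.prems(1)] Ck_on_differentiable[OF Suc.prems(2)]]])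
      (use Suc in auto)
qed

text \<open>Leibniz rule: the derivative is a sum of two terms of the same bilinear shape, so the
  induction has to range over all \<open>f\<close> and \<open>g\<close> at once.\<close>

lemma Ck_on_bounded_bilinear:
  assumes "bounded_bilinear p" "open S" "Ck_on k f S" "Ck_on k g S"
  shows "Ck_on k (\<lambda>x. p (f x) (g x)) S"
  using assms(3,4)
proof (induction k arbitrary: f g)
  case 0
  then show ?case using assms by (simp add: bounded_bilinear.continuous_on)
next
  case (Suc k)
  show ?case
    by (rule Ck_on_SucI[OF assms(2) bounded_bilinear.FDERIV[OF assms(1) Ck_on_differentiable[OF Suc.prems(1)] Ck_on_differentiable[OF Suc.prems(2)]]])
      (use Suc in \<open>auto intro!: Ck_on_add[OF assms(2)] Suc.IH intro: Ck_on_SucD\<close>)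
qed

lemma Ck_on_sum:
  assumes "open S" "finite I" "\<And>i. i \<in> I \<Longrightarrow> Ck_on k (f i) S"
  shows "Ck_on k (\<lambda>x. \<Sum>i\<in>I. f i x) S"
  using assms(2,3) by (induction I) (auto intro: Ck_on_const Ck_on_add assms(1))

lemma Ck_on_compose:
  fixes g :: "'b::euclidean_space \<Rightarrow> 'c::real_normed_vector"
  assumes "open S" "open T" "f ` S \<subseteq> T" "Ck_on k f S" "Ck_on k g T"
  shows "Ck_on k (\<lambda>x. g (f x)) S"
  using assms(4,5)
proof (induction k arbitrary: g)
  case 0
  then show ?case using assms(3) by (auto intro: continuous_on_compose2)
next
  case (Suc k)
  let ?f' = "\<lambda>x. frechet_derivative f (at x)" and ?g' = "\<lambda>x. frechet_derivative g (at x)"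
  show ?case
  proof (rule Ck_on_SucI[OF assms(1)])
    fix x assume x: "x \<in> S"
    then have g: "(g has_derivative ?g' (f x)) (at (f x))"
      using assms(3) Ck_on_differentiable[OF Suc.prems(2)] by blast
    have "((\<lambda>x. g (f x)) has_derivative (\<lambda>v. ?g' (f x) (?f' x v))) (at x)"
      by (rule has_derivative_compose[OF Ck_on_differentiable[OF Suc.prems(1) x] g])
    \<comment> \<open>The direction in which \<open>g\<close> is differentiated varies with
      \<open>x\<close>. Expanding it in the basis leaves derivatives of \<open>g\<close> in fixed
      directions, to which the induction hypothesis applies.\<close>
    moreover have "?g' (f x) w = (\<Sum>b\<in>Basis. (w \<bullet> b) *\<^sub>R ?g' (f x) b)" for w
    proof -
      interpret linear "?g' (f x)" using g has_derivative_linear by blast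
      have "?g' (f x) w = ?g' (f x) (\<Sum>b\<in>Basis. (w \<bullet> b) *\<^sub>R b)" by (simp add: euclidean_representation)
      then show ?thesis by (simp only: sum scaleR)
    qed
    ultimately show "((\<lambda>x. g (f x)) has_derivative
        (\<lambda>v. \<Sum>b\<in>Basis. (?f' x v \<bullet> b) *\<^sub>R ?g' (f x) b)) (at x)"
      by (metis (no_types, lifting) ext)
  next
    fix v
    have "Ck_on k (\<lambda>x. (?f' x v \<bullet> b) *\<^sub>R ?g' (f x) b) S" for b
    proof (rule Ck_on_bounded_bilinear[OF bounded_bilinear_scaleR assms(1)])
      show "Ck_on k (\<lambda>x. ?f' x v \<bullet> b) S"
        using Suc.prems by (intro Ck_on_bounded_linear_comp[OF bounded_linear_inner_left assms(1)]) auto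
      show "Ck_on k (\<lambda>x. ?g' (f x) b) S"
        using Suc.prems by (intro Suc.IH) (auto intro: Ck_on_SucD)
    qed
    then show "Ck_on k (\<lambda>x. \<Sum>b\<in>Basis. (?f' x v \<bullet> b) *\<^sub>R ?g' (f x) b) S"
      by (intro Ck_on_sum assms(1)) auto
  qed
qed

lemma smooth_on_cong:
  "open S \<Longrightarrow> (\<And>x. x \<in> S \<Longrightarrow> f x = g x) \<Longrightarrow> smooth_on f S \<Longrightarrow> smooth_on g S"
  unfolding smooth_on_def using Ck_on_cong by blast

lemma smooth_on_const: "open S \<Longrightarrow> smooth_on (\<lambda>x. c) S"
  by (simp add: smooth_on_def Ck_on_const)

lemma smooth_on_add: "open S \<Longrightarrow> smooth_on f S \<Longrightarrow> smooth_on g S \<Longrightarrow> smooth_on (\<lambda>x. f x + g x) S"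
  by (simp add: smooth_on_def Ck_on_add)

lemma smooth_on_bounded_linear_comp:
  "bounded_linear h \<Longrightarrow> open S \<Longrightarrow> smooth_on f S \<Longrightarrow> smooth_on (\<lambda>x. h (f x)) S"
  by (simp add: smooth_on_def Ck_on_bounded_linear_comp)

lemma smooth_on_bounded_bilinear:
  "bounded_bilinear p \<Longrightarrow> open S \<Longrightarrow> smooth_on f S \<Longrightarrow> smooth_on g S \<Longrightarrow> smooth_on (\<lambda>x. p (f x) (g x)) S"
  by (simp add: smooth_on_def Ck_on_bounded_bilinear)

lemmas smooth_on_mult = smooth_on_bounded_bilinear[OF bounded_bilinear_mult]
lemmas smooth_on_scaleR = smooth_on_bounded_bilinear[OF bounded_bilinear_scaleR]
lemmas smooth_on_inner = smooth_on_bounded_bilinear[OF bounded_bilinear_inner]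
lemmas smooth_on_minus = smooth_on_bounded_linear_comp[OF bounded_linear_minus[OF bounded_linear_ident]]
lemmas smooth_on_vec_nth = smooth_on_bounded_linear_comp[OF bounded_linear_vec_nth]

lemma smooth_on_diff:
  "open S \<Longrightarrow> smooth_on f S \<Longrightarrow> smooth_on g S \<Longrightarrow> smooth_on (\<lambda>x. f x - g x) S"
  using smooth_on_add[OF _ _ smooth_on_minus, of S f g] by simp

lemma smooth_on_sum:
  "open S \<Longrightarrow> finite I \<Longrightarrow> (\<And>i. i \<in> I \<Longrightarrow> smooth_on (f i) S) \<Longrightarrow> smooth_on (\<lambda>x. \<Sum>i\<in>I. f i x) S"
  by (simp add: smooth_on_def Ck_on_sum)

lemma smooth_on_prod:
  fixes f :: "'i \<Rightarrow> 'a::real_normed_vector \<Rightarrow> real"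
  assumes "open S" "finite I" "\<And>i. i \<in> I \<Longrightarrow> smooth_on (f i) S"
  shows "smooth_on (\<lambda>x. \<Prod>i\<in>I. f i x) S"
  using assms(2,3) by (induction I) (auto intro: smooth_on_const smooth_on_mult assms(1))

lemma smooth_on_power2:
  fixes f :: "'a::real_normed_vector \<Rightarrow> real"
  shows "open S \<Longrightarrow> smooth_on f S \<Longrightarrow> smooth_on (\<lambda>x. (f x)\<^sup>2) S"
  by (simp add: power2_eq_square smooth_on_mult)

lemma smooth_on_compose:
  fixes g :: "'b::euclidean_space \<Rightarrow> 'c::real_normed_vector"
  shows "smooth_on g T \<Longrightarrow> open S \<Longrightarrow> open T \<Longrightarrow> f ` S \<subseteq> T \<Longrightarrow> smooth_on f S \<Longrightarrow> smooth_on (\<lambda>x. g (f x)) S"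
  by (simp add: smooth_on_def Ck_on_compose)

lemma Ck_on_bounded_linear:
  assumes "bounded_linear h" "open S" shows "Ck_on k h S"
proof (cases k)
  case 0
  then show ?thesis using assms by (simp add: linear_continuous_on)
next
  case (Suc m)
  have "Ck_on (Suc m) h S"
    by (rule Ck_on_SucI[OF assms(2) bounded_linear.has_derivative[OF assms(1) has_derivative_ident] Ck_on_const[OF assms(2)]])
  then show ?thesis using Suc by simp
qed

lemma smooth_on_bounded_linear: "bounded_linear h \<Longrightarrow> open S \<Longrightarrow> smooth_on h S"
  by (simp add: smooth_on_def Ck_on_bounded_linear)

lemma smooth_on_frechet_derivative:
  "smooth_on f S \<Longrightarrow> smooth_on (\<lambda>x. frechet_derivative f (at x) v) S"
  unfolding smooth_on_def using Ck_on.simps(2) by blast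

lemma smooth_on_has_derivative:
  "smooth_on f S \<Longrightarrow> x \<in> S \<Longrightarrow> (f has_derivative frechet_derivative f (at x)) (at x)"
  unfolding smooth_on_def using Ck_on_differentiable by blast

lemma smooth_on_imp_continuous_on: "smooth_on f S \<Longrightarrow> continuous_on S f"
  unfolding smooth_on_def using Ck_on.simps(1) by blast

lemma smooth_on_subset:
  assumes "smooth_on f S" "T \<subseteq> S" shows "smooth_on f T"
proof -
  have "Ck_on k f T" if "Ck_on k f S" for k
    using that by (induction k arbitrary: f) (use assms(2) in \<open>auto intro: continuous_on_subset\<close>)
  then show ?thesis using assms(1) by (simp add: smooth_on_def)
qed

section \<open>Elementary functions of a real variable\<close>

lemma Ck_on_real_SucI:
  fixes f :: "real \<Rightarrow> real"
  assumes "open S" "\<And>x. x \<in> S \<Longrightarrow> (f has_real_derivative f' x) (at x)" "Ck_on k f' S"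
  shows "Ck_on (Suc k) f S"
proof (rule Ck_on_SucI[OF assms(1)])
  show "(f has_derivative (\<lambda>v. f' x * v)) (at x)" if "x \<in> S" for x
    using assms(2)[OF that] by (simp add: has_field_derivative_def)
  show "Ck_on k (\<lambda>x. f' x * v) S" for v
    by (rule Ck_on_bounded_linear_comp[OF bounded_linear_mult_left assms(1,3)])
qed

lemma smooth_on_elementary:
  "smooth_on (inverse :: real \<Rightarrow> real) (- {0})"
  "smooth_on (exp :: real \<Rightarrow> real) UNIV"
  "smooth_on (sin :: real \<Rightarrow> real) UNIV"
  "smooth_on (cos :: real \<Rightarrow> real) UNIV"
proof -
  have n: "Ck_on k (\<lambda>x. - f x) S" if "Ck_on k f S" "open S" for k and f :: "real \<Rightarrow> real" and S
    using Ck_on_bounded_linear_comp[OF bounded_linear_minus[OF bounded_linear_ident] that(2,1)] .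
  have "Ck_on k (inverse :: real \<Rightarrow> real) (- {0})" for k
  proof (induction k)
    case (Suc k)
    show ?case
      by (rule Ck_on_real_SucI[where f' = "\<lambda>x. - (inverse x * inverse x)"])
        (auto intro!: derivative_eq_intros n Ck_on_bounded_bilinear[OF bounded_bilinear_mult] Suc)
  qed (auto intro!: continuous_on_inverse continuous_on_id)
  then show "smooth_on (inverse :: real \<Rightarrow> real) (- {0})" by (simp add: smooth_on_def)
  have "Ck_on k (exp :: real \<Rightarrow> real) UNIV" for k
  proof (induction k)
    case (Suc k)
    show ?case by (rule Ck_on_real_SucI[OF _ _ Suc]) (auto intro!: derivative_eq_intros)
  qed (auto intro!: continuous_intros)
  then show "smooth_on (exp :: real \<Rightarrow> real) UNIV" by (simp add: smooth_on_def)
  \<comment> \<open>Each function is, up to sign, the derivative of the other, so only the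
    conjunction is inductive.\<close>
  have "Ck_on k (sin :: real \<Rightarrow> real) UNIV \<and> Ck_on k (cos :: real \<Rightarrow> real) UNIV" for k
  proof (induction k)
    case (Suc k)
    have "Ck_on (Suc k) (sin :: real \<Rightarrow> real) UNIV"
      by (rule Ck_on_real_SucI[OF _ _ conjunct2[OF Suc]]) (auto intro!: derivative_eq_intros)
    moreover have "Ck_on (Suc k) (cos :: real \<Rightarrow> real) UNIV"
      by (rule Ck_on_real_SucI[OF _ _ n[OF conjunct1[OF Suc]]]) (auto intro!: derivative_eq_intros)
    ultimately show ?case by blast
  qed (auto intro!: continuous_intros)
  then show "smooth_on (sin :: real \<Rightarrow> real) UNIV" "smooth_on (cos :: real \<Rightarrow> real) UNIV"
    by (auto simp: smooth_on_def)
qed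

text \<open>Serves ln and arctan, whose derivatives are rational and hence already known to be
  smooth.\<close>

lemma smooth_on_real_deriv:
  fixes f :: "real \<Rightarrow> real"
  assumes "open S" "\<And>x. x \<in> S \<Longrightarrow> (f has_real_derivative f' x) (at x)" "smooth_on f' S"
  shows "smooth_on f S"
proof -
  have "Ck_on (Suc k) f S" for k
    using assms by (intro Ck_on_real_SucI) (auto simp: smooth_on_def)
  then show ?thesis unfolding smooth_on_def using Ck_on_SucD by blast
qed

context
  fixes S :: "'a::real_normed_vector set" and f :: "'a \<Rightarrow> real"
  assumes S: "open S" and f: "smooth_on f S"
begin

lemma smooth_on_inverse: "(\<And>x. x \<in> S \<Longrightarrow> f x \<noteq> 0) \<Longrightarrow> smooth_on (\<lambda>x. inverse (f x)) S"
  using S f by (intro smooth_on_compose[OF smooth_on_elementary(1)]) auto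

lemma smooth_on_exp: "smooth_on (\<lambda>x. exp (f x)) S"
  using S f by (intro smooth_on_compose[OF smooth_on_elementary(2)]) auto

lemma smooth_on_sin: "smooth_on (\<lambda>x. sin (f x)) S"
  using S f by (intro smooth_on_compose[OF smooth_on_elementary(3)]) auto

lemma smooth_on_cos: "smooth_on (\<lambda>x. cos (f x)) S"
  using S f by (intro smooth_on_compose[OF smooth_on_elementary(4)]) auto

end

lemma smooth_on_divide:
  fixes f g :: "'a::real_normed_vector \<Rightarrow> real"
  shows "open S \<Longrightarrow> smooth_on f S \<Longrightarrow> smooth_on g S \<Longrightarrow> (\<And>x. x \<in> S \<Longrightarrow> g x \<noteq> 0) \<Longrightarrow> smooth_on (\<lambda>x. f x / g x) S"
  unfolding divide_inverse by (intro smooth_on_mult smooth_on_inverse)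

lemma smooth_on_ln:
  fixes f :: "'a::real_normed_vector \<Rightarrow> real"
  assumes "open S" "smooth_on f S" "\<And>x. x \<in> S \<Longrightarrow> f x > 0"
  shows "smooth_on (\<lambda>x. ln (f x)) S"
proof -
  have "smooth_on (ln :: real \<Rightarrow> real) {0<..}"
    by (rule smooth_on_real_deriv[where f' = inverse])
      (auto intro!: derivative_eq_intros intro: smooth_on_subset[OF smooth_on_elementary(1)] simp: inverse_eq_divide)
  from smooth_on_compose[OF this assms(1) _ _ assms(2)] show ?thesis using assms by auto
qed

lemma smooth_on_powr:
  fixes f g :: "'a::real_normed_vector \<Rightarrow> real"
  assumes "open S" "smooth_on f S" "smooth_on g S" "\<And>x. x \<in> S \<Longrightarrow> f x > 0"
  shows "smooth_on (\<lambda>x. f x powr g x) S"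
proof (rule smooth_on_cong[OF assms(1)])
  show "smooth_on (\<lambda>x. exp (g x * ln (f x))) S"
    using assms by (intro smooth_on_exp smooth_on_mult smooth_on_ln)
  show "exp (g x * ln (f x)) = f x powr g x" if "x \<in> S" for x
    using assms(4)[OF that] by (simp add: powr_def)
qed

lemma smooth_on_sqrt:
  fixes f :: "'a::real_normed_vector \<Rightarrow> real"
  assumes "open S" "smooth_on f S" "\<And>x. x \<in> S \<Longrightarrow> f x > 0"
  shows "smooth_on (\<lambda>x. sqrt (f x)) S"
proof (rule smooth_on_cong[OF assms(1)])
  show "smooth_on (\<lambda>x. f x powr (1/2)) S"
    using assms by (intro smooth_on_powr smooth_on_const)
  show "f x powr (1/2) = sqrt (f x)" if "x \<in> S" for x
    using assms(3)[OF that] by (simp add: powr_half_sqrt)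
qed

lemma smooth_on_ident: "open S \<Longrightarrow> smooth_on (\<lambda>x. x) S"
  by (rule smooth_on_bounded_linear[OF bounded_linear_ident])

lemma smooth_on_arctan:
  fixes f :: "'a::real_normed_vector \<Rightarrow> real"
  assumes "open S" "smooth_on f S"
  shows "smooth_on (\<lambda>x. arctan (f x)) S"
proof -
  have "1 + x\<^sup>2 \<noteq> 0" for x :: real
    by (smt (verit) zero_le_power2)
  then have "smooth_on (\<lambda>x::real. inverse (1 + x\<^sup>2)) UNIV"
    by (intro smooth_on_inverse smooth_on_add smooth_on_const smooth_on_power2 smooth_on_ident) auto
  then have "smooth_on (arctan :: real \<Rightarrow> real) UNIV"
    by (rule smooth_on_real_deriv[OF open_UNIV DERIV_arctan])
  from smooth_on_compose[OF this assms(1) _ _ assms(2)] show ?thesis using assms by auto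
qed

lemma smooth_on_vec_lambda:
  fixes f :: "'i::finite \<Rightarrow> 'a::real_normed_vector \<Rightarrow> real"
  assumes "open S" "\<And>i. smooth_on (f i) S"
  shows "smooth_on (\<lambda>x. \<chi> i. f i x) S"
proof (rule smooth_on_cong[OF assms(1)])
  show "(\<Sum>i\<in>UNIV. f i x *\<^sub>R axis i 1) = (\<chi> i. f i x)" for x
    by (simp add: vec_eq_iff axis_def if_distrib cong: if_cong)
  show "smooth_on (\<lambda>x. \<Sum>i\<in>UNIV. f i x *\<^sub>R axis i 1) S"
    by (intro smooth_on_sum smooth_on_scaleR smooth_on_const assms) auto
qed

lemma smooth_on_det:
  fixes M :: "'a::real_normed_vector \<Rightarrow> real^'i^'i"
  assumes "open S" "\<And>i j. smooth_on (\<lambda>x. M x $ i $ j) S"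
  shows "smooth_on (\<lambda>x. det (M x)) S"
  unfolding det_def
  by (intro smooth_on_sum smooth_on_mult smooth_on_prod smooth_on_const assms) auto

lemma smooth_on_real_has_deriv:
  fixes f :: "real \<Rightarrow> real"
  assumes "smooth_on f S" "x \<in> S"
  shows "(f has_real_derivative deriv f x) (at x)"
  using smooth_on_has_derivative[OF assms] DERIV_deriv_iff_real_differentiable differentiableI by blast

lemma smooth_on_deriv:
  fixes f :: "real \<Rightarrow> real"
  assumes "open S" "smooth_on f S"
  shows "smooth_on (deriv f) S"
proof (rule smooth_on_cong[OF assms(1) _ smooth_on_frechet_derivative[OF assms(2)]])
  fix x assume "x \<in> S"
  then have "(f has_derivative (*) (deriv f x)) (at x)"
    using smooth_on_real_has_deriv[OF assms(2)] by (simp add: has_field_derivative_def)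
  from frechet_derivative_at[OF this] show "frechet_derivative f (at x) 1 = deriv f x"
    by (metis mult.right_neutral)
qed

section \<open>Maps on products: pairs, slices and partial derivatives\<close>

lemma smooth_on_Pair:
  assumes "open S" "smooth_on f S" "smooth_on g S"
  shows "smooth_on (\<lambda>x. (f x, g x)) S"
proof -
  have "smooth_on (\<lambda>x. (f x, 0) + (0, g x)) S"
    by (rule smooth_on_add[OF assms(1) smooth_on_bounded_linear_comp[OF _ assms(1,2)]
          smooth_on_bounded_linear_comp[OF _ assms(1,3)]])
      (intro bounded_linear_Pair bounded_linear_ident bounded_linear_zero)+
  then show ?thesis by simp
qed

lemma smooth_on_fst_comp:
  fixes f :: "'a::euclidean_space \<Rightarrow> 'c::real_normed_vector" and S :: "('a \<times> 'b::real_normed_vector) set"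
  assumes "smooth_on f U" "open U" "open S" "\<And>p. p \<in> S \<Longrightarrow> fst p \<in> U"
  shows "smooth_on (\<lambda>p. f (fst p)) S"
  by (rule smooth_on_compose[OF assms(1,3,2) _ smooth_on_bounded_linear[OF bounded_linear_fst assms(3)]])
    (use assms(4) in auto)

lemma smooth_on_snd:
  "open S \<Longrightarrow> smooth_on snd S"
  by (rule smooth_on_bounded_linear[OF bounded_linear_snd])

lemma open_slice:
  fixes S :: "('a::topological_space \<times> 'b::topological_space) set"
  assumes "open S" shows "open {y. (x, y) \<in> S}"
proof -
  have "continuous_on UNIV (Pair x :: 'b \<Rightarrow> _)" by (intro continuous_intros)
  from open_vimage[OF assms this] show ?thesis by (simp add: vimage_def)
qed

lemma smooth_on_slice:
  fixes f :: "'a::euclidean_space \<Rightarrow> 'b::euclidean_space \<Rightarrow> 'c::real_normed_vector"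
  assumes "open S" "smooth_on (\<lambda>(x, y). f x y) S"
  shows "smooth_on (f x) {y. (x, y) \<in> S}"
  using smooth_on_compose[OF assms(2) open_slice[OF assms(1)] assms(1) _
      smooth_on_Pair[OF open_slice[OF assms(1)] smooth_on_const[OF open_slice[OF assms(1)]]
        smooth_on_ident[OF open_slice[OF assms(1)]]], of x x]
  by auto

text \<open>The derivative in \<open>w\<close> alone is the total derivative in the direction
  \<open>(0, 1)\<close>, hence smooth jointly in both variables.\<close>

lemma smooth_on_partial_deriv:
  fixes f :: "'a::real_normed_vector \<Rightarrow> real \<Rightarrow> real"
  assumes S: "open S" and f: "smooth_on (\<lambda>(x, w). f x w) S"
  shows "smooth_on (\<lambda>(x, w). deriv (f x) w) S"
proof (rule smooth_on_cong[OF S _ smooth_on_frechet_derivative[OF f]])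
  fix p assume p: "p \<in> S"
  obtain x w where xw: "p = (x, w)" by fastforce
  define G where "G = frechet_derivative (\<lambda>(x, w). f x w) (at p)"
  have G: "((\<lambda>(x, w). f x w) has_derivative G) (at (x, w))"
    unfolding G_def xw[symmetric] by (rule smooth_on_has_derivative[OF f p])
  interpret G: linear G using G by (rule has_derivative_linear)
  have "((\<lambda>w. (x, w)) has_derivative (\<lambda>h. (0, h))) (at w)"
    by (intro has_derivative_Pair has_derivative_const has_derivative_ident)
  from has_derivative_compose[OF this G]
  have "(f x has_derivative (\<lambda>h. G (0, h))) (at w)" by simp
  moreover have "G (0, h) = G (0, 1) * h" for h
    using G.scaleR[of h "(0, 1)"] by (simp add: mult.commute)
  then have "(\<lambda>h. G (0, h)) = (*) (G (0, 1))" by (rule ext)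
  ultimately have "(f x has_real_derivative G (0, 1)) (at w)"
    unfolding has_field_derivative_def by (simp only:)
  then show "frechet_derivative (\<lambda>(x, w). f x w) (at p) (0, 1) = (case p of (x, w) \<Rightarrow> deriv (f x) w)"
    unfolding G_def[symmetric] by (simp add: xw DERIV_imp_deriv)
qed

text \<open>An injective linear endomorphism of a Euclidean space is invertible, so the inverse
  function theorem applies at every point.\<close>

lemma locally_invertible_on_inj_derivative:
  fixes f :: "'a::euclidean_space \<Rightarrow> 'a"
  assumes D: "open D" and f: "smooth_on f D"
    and inj: "\<And>y. y \<in> D \<Longrightarrow> inj (frechet_derivative f (at y))"
  shows "locally_invertible_on f D"
  unfolding locally_invertible_on_def
proof
  fix y assume y: "y \<in> D"
  define f' where "f' z = Blinfun (frechet_derivative f (at z))" for z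
  have d: "(f has_derivative frechet_derivative f (at z)) (at z)" if "z \<in> D" for z
    by (rule smooth_on_has_derivative[OF f that])
  have f': "blinfun_apply (f' z) = frechet_derivative f (at z)" if "z \<in> D" for z
    unfolding f'_def by (rule bounded_linear_Blinfun_apply[OF has_derivative_bounded_linear[OF d[OF that]]])
  \<comment> \<open>In finite dimension, continuity in operator norm follows from continuity on each
    basis vector, which smoothness provides.\<close>
  have cont: "continuous_on D f'"
  proof (rule continuous_on_blinfun_componentwise)
    fix i :: 'a
    have "continuous_on D (\<lambda>z. frechet_derivative f (at z) i)"
      by (rule smooth_on_imp_continuous_on[OF smooth_on_frechet_derivative[OF f]])
    then show "continuous_on D (\<lambda>z. blinfun_apply (f' z) i)"
      by (rule continuous_on_eq) (simp add: f')
  qed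
  obtain g where g: "linear g" "g \<circ> frechet_derivative f (at y) = id"
    using linear_injective_left_inverse[OF has_derivative_linear[OF d[OF y]] inj[OF y]] by blast
  have inv: "Blinfun g o\<^sub>L f' y = id_blinfun"
    using g by (intro blinfun_eqI)
      (simp add: f'[OF y] bounded_linear_Blinfun_apply linear_conv_bounded_linear[symmetric] fun_eq_iff)
  have "(f has_derivative blinfun_apply (f' z)) (at z)" if "z \<in> D" for z
    using d[OF that] f'[OF that] by simp
  from inverse_function_theorem[OF D this cont y inv]
  obtain A B g where "open A" "A \<subseteq> D" "y \<in> A" "open B" "homeomorphism A B f g"
    by metis
  then show "\<exists>A g. open A \<and> y \<in> A \<and> A \<subseteq> D \<and> open (f ` A) \<and> homeomorphism A (f ` A) f g"
    by (metis homeomorphism_image1)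
qed

section \<open>The geometry of a tangent space\<close>

text \<open>Product rule applied twice: half the Hessian of F^2 is dF dF + F d^2F. In
  \<open>d2F v\<close> the direction \<open>v\<close> of the first differentiation is held
  fixed.\<close>

lemma fundamental_tensor_eq:
  assumes "open D" "y \<in> D"
    and F: "\<And>z. z \<in> D \<Longrightarrow> (F x has_derivative dF z) (at z)"
    and dF: "\<And>v. ((\<lambda>z. dF z v) has_derivative d2F v) (at y)"
  shows "fundamental_tensor F x y $ m $ n =
    dF y (axis m 1) * dF y (axis n 1) + F x y * d2F (axis n 1) (axis m 1)"
proof -
  have 1: "partial (\<lambda>z. (F x z)\<^sup>2) n z = 2 * (F x z * dF z (axis n 1))" if "z \<in> D" for z
  proof -
    have "((\<lambda>z. F x z * F x z) has_derivative (\<lambda>v. F x z * dF z v + dF z v * F x z)) (at z)"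
      by (intro has_derivative_mult F[OF that])
    then have "((\<lambda>z. (F x z)\<^sup>2) has_derivative (\<lambda>v. 2 * (F x z * dF z v))) (at z)"
      by (simp add: power2_eq_square mult.commute)
    from frechet_derivative_at[OF this] show ?thesis
      unfolding partial_def by (simp only: fun_eq_iff)
  qed
  have "((\<lambda>z. 2 * (F x z * dF z (axis n 1))) has_derivative
      (\<lambda>v. 2 * (F x y * d2F (axis n 1) v + dF y v * dF y (axis n 1)))) (at y)"
    by (intro has_derivative_mult_right has_derivative_mult F[OF assms(2)] dF)
  then have "(partial (\<lambda>z. (F x z)\<^sup>2) n has_derivative
      (\<lambda>v. 2 * (F x y * d2F (axis n 1) v + dF y v * dF y (axis n 1)))) (at y)"
    by (rule has_derivative_transform_within_open[OF _ assms(1,2)]) (simp add: 1)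
  from frechet_derivative_at[OF this]
  have "partial (partial (\<lambda>z. (F x z)\<^sup>2) n) m y =
      2 * (F x y * d2F (axis n 1) (axis m 1) + dF y (axis m 1) * dF y (axis n 1))"
    unfolding partial_def by (simp only: fun_eq_iff)
  then show ?thesis by (simp add: fundamental_tensor_def)
qed

section \<open>Orthogonal splitting of one tangent space along the 1-form\<close>

locale fs_point =
  fixes a :: "real^'n \<Rightarrow> real^'n^'n" and \<beta> :: "real^'n \<Rightarrow> real^'n" and x :: "real^'n"
  assumes symm: "transpose (a x) = a x"
    and pos: "v \<noteq> 0 \<Longrightarrow> v \<bullet> (a x *v v) > 0"
    and c_pos: "0 < c_norm a \<beta> x" and c_less: "c_norm a \<beta> x < 1"
begin

definition ip :: "real^'n \<Rightarrow> real^'n \<Rightarrow> real" where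
  "ip u v = u \<bullet> (a x *v v)"

abbreviation "B \<equiv> b_up a \<beta> x"
abbreviation "e \<equiv> b_up_unit a \<beta> x"
abbreviation "c \<equiv> c_norm a \<beta> x"
abbreviation "b \<equiv> one_form \<beta> x"
abbreviation "r \<equiv> qt_fun a \<beta> x"
abbreviation "iv \<equiv> i_vec a \<beta> x"
abbreviation "u \<equiv> wt_fun a \<beta> x"
abbreviation "wv \<equiv> w_fun a \<beta> x"

text \<open>The \<open>ip\<close>-orthogonal projection onto the kernel of \<open>b\<close>.\<close>

definition perp :: "real^'n \<Rightarrow> real^'n" where
  "perp y = y - (b y / c\<^sup>2) *\<^sub>R B"

text \<open>The differential of \<open>u\<close>, by \<open>has_derivative_u\<close>.\<close>

definition du :: "real^'n \<Rightarrow> real^'n \<Rightarrow> real" where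
  "du y v = (ip (iv y) v - u y * b v) / b y"

text \<open>The part of \<open>ip\<close> orthogonal to \<open>e\<close> and \<open>iv y\<close>: up
  to the factor r^2 it is the round metric of the sphere of directions, pulled back along
  \<open>iv\<close>.\<close>

definition K :: "real^'n \<Rightarrow> real^'n \<Rightarrow> real^'n \<Rightarrow> real" where
  "K y v w = ip (perp v) (perp w) - ip (iv y) v * ip (iv y) w"

sublocale ip: bounded_bilinear ip
  unfolding ip_def[abs_def]
  by (rule bounded_bilinear.comp[OF bounded_bilinear_inner bounded_linear_ident matrix_vector_mul_bounded_linear])

lemma ip_commute: "ip v w = ip w v"
proof -
  have "v v* a x = a x *v v"
    using transpose_matrix_vector[of "a x" v] by (simp add: symm)
  then have "v \<bullet> (a x *v w) = (a x *v v) \<bullet> w"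
    using dot_lmul_matrix[of v "a x" w] by simp
  then show ?thesis
    unfolding ip_def by (simp only: inner_commute)
qed

lemma ip_pos: "v \<noteq> 0 \<Longrightarrow> ip v v > 0"
  unfolding ip_def by (rule pos)

sublocale b: bounded_linear b
  unfolding one_form_def[abs_def] by (rule bounded_linear_inner_right)

lemma invertible_a: "invertible (a x)"
proof -
  have "v = 0" if "a x *v v = 0" for v
    using pos[of v] that by (cases "v = 0") simp_all
  then show ?thesis
    by (simp add: invertible_left_inverse matrix_left_invertible_ker)
qed

lemma a_B: "a x *v B = \<beta> x"
proof -
  have "a x ** matrix_inv (a x) = mat 1"
    using someI_ex[OF invertible_a[unfolded invertible_def]] by (simp add: matrix_inv_def)
  then show ?thesis by (simp add: b_up_def matrix_vector_mul_assoc)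
qed

lemma ip_B: "ip v B = b v"
  by (simp add: ip_def a_B one_form_def inner_commute)

lemma ip_B': "ip B v = b v"
  by (subst ip_commute) (rule ip_B)

lemma b_B: "b B = c\<^sup>2"
proof -
  have "\<beta> x \<bullet> B > 0"
    using c_pos unfolding c_norm_def by simp
  then show ?thesis by (simp add: c_norm_def one_form_def)
qed

lemma linear_perp: "bounded_linear perp"
proof -
  have "bounded_linear (\<lambda>y. (b y / c\<^sup>2) *\<^sub>R B)"
    by (rule bounded_linear_compose[OF bounded_linear_scaleR_left
          bounded_linear_compose[OF bounded_linear_divide b.bounded_linear_axioms]])
  then show ?thesis
    unfolding perp_def[abs_def] by (rule bounded_linear_sub[OF bounded_linear_ident])
qed

lemma ip_perp_perp: "ip (perp v) (perp w) = ip v w - b v * b w / c\<^sup>2"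
  using c_pos by (simp add: perp_def ip.diff_left ip.diff_right ip.scaleR_left ip.scaleR_right ip_B ip_B' b_B b.diff b.scaleR)

lemma ip_perp_e: "ip (perp v) e = 0"
  using c_pos by (simp add: perp_def b_up_unit_def ip.diff_left ip.scaleR_left ip.scaleR_right ip_B b_B b.diff b.scaleR)

lemma ip_e_e: "ip e e = 1"
  using c_pos by (simp add: b_up_unit_def ip.scaleR_left ip.scaleR_right ip_B b_B b.scaleR power2_eq_square)

text \<open>Cauchy-Schwarz for \<open>y\<close> and \<open>B\<close>, read off from the squared
  length of \<open>perp y\<close>.\<close>

lemma ip_ge_b: "ip y y - (b y)\<^sup>2 / c\<^sup>2 \<ge> 0"
  using ip_perp_perp[of y y] ip_pos[of "perp y"] ip.zero_left
  by (cases "perp y = 0") (auto simp: power2_eq_square)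

lemma q_eq: "(q_fun a \<beta> x y)\<^sup>2 = ip y y - (b y)\<^sup>2"
proof -
  \<comment> \<open>Here \<open>c < 1\<close> enters: it weakens the bound of \<open>ip_ge_b\<close>
    to the nonnegativity of the radicand of q.\<close>
  have "(b y)\<^sup>2 \<le> (b y)\<^sup>2 / c\<^sup>2"
    using c_pos c_less by (simp add: pos_le_divide_eq mult_left_le power_le_one)
  then have "ip y y - (b y)\<^sup>2 \<ge> 0" using ip_ge_b[of y] by linarith
  then show ?thesis by (simp add: q_fun_def ip_def)
qed

text \<open>The two multiples of b^2 combine, and the radicand becomes the squared length of
  \<open>perp y\<close>; this is why dividing \<open>perp y\<close> by r normalises it.\<close>

lemma r_eq: "r y = sqrt (ip y y - (b y)\<^sup>2 / c\<^sup>2)"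
  unfolding qt_fun_def q_eq by (simp add: algebra_simps)

lemma r_power2: "(r y)\<^sup>2 = ip y y - (b y)\<^sup>2 / c\<^sup>2"
  using ip_ge_b by (simp add: r_eq)

lemma iv_eq: "iv y = (1 / r y) *\<^sub>R perp y"
  by (simp add: i_vec_def perp_def)

lemma ip_perp: "ip (perp y) v = ip y v - b y * b v / c\<^sup>2"
  by (simp add: perp_def ip.diff_left ip.scaleR_left ip_B')

lemma ip_iv: "ip (iv y) v = (ip y v - b y * b v / c\<^sup>2) / r y"
  by (simp add: iv_eq ip.scaleR_left ip_perp)

lemma ip_iv_e: "ip (iv y) e = 0"
  by (simp add: iv_eq ip.scaleR_left ip_perp_e)

lemma ip_iv_perp: "ip (iv y) (perp v) = ip (iv y) v"
  using c_pos by (simp add: iv_eq ip.scaleR_left ip_perp_perp ip_perp[symmetric])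

lemma ip_flip:
  "ip e (perp v) = 0" "ip e (iv y) = 0" "ip (perp v) (iv y) = ip (iv y) v"
  by (subst ip_commute, simp add: ip_perp_e ip_iv_e ip_iv_perp)+

lemma ip_iv_iv: "r y > 0 \<Longrightarrow> ip (iv y) (iv y) = 1"
proof -
  assume *: "r y > 0"
  have "ip (perp y) (perp y) = (r y)\<^sup>2"
    by (simp add: ip_perp_perp r_power2 flip: power2_eq_square)
  then show ?thesis
    using * by (simp add: iv_eq ip.scaleR_left ip.scaleR_right power2_eq_square)
qed

section \<open>Differentials of the polar variables \<open>r\<close>, \<open>iv\<close> and
  \<open>u\<close>\<close>

lemma has_derivative_r:
  assumes "r y > 0" shows "(r has_derivative ip (iv y)) (at y)"
proof -
  have p: "ip y y - (b y)\<^sup>2 / c\<^sup>2 > 0"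
    using assms unfolding r_eq by simp
  have "((\<lambda>y. ip y y - (b y)\<^sup>2 / c\<^sup>2) has_derivative (\<lambda>v. 2 * r y * ip (iv y) v)) (at y)"
  proof -
    have "((\<lambda>y. ip y y - (1 / c\<^sup>2) * (b y * b y)) has_derivative
        (\<lambda>v. (ip y v + ip v y) - (1 / c\<^sup>2) * (b y * b v + b v * b y))) (at y)"
      by (intro has_derivative_diff ip.FDERIV has_derivative_mult_right has_derivative_mult b.has_derivative has_derivative_ident)
    moreover have "(ip y v + ip v y) - (1 / c\<^sup>2) * (b y * b v + b v * b y) = 2 * r y * ip (iv y) v" for v
    proof -
      have "2 * r y * ip (iv y) v = 2 * (r y * ip (iv y) v)" by simp
      also have "\<dots> = 2 * (ip y v - b y * b v / c\<^sup>2)" using assms by (simp add: ip_iv)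
      finally show ?thesis by (simp add: ip_commute[of v y] mult.commute[of "b v"])
    qed
    ultimately show ?thesis by (simp add: power2_eq_square)
  qed
  from DERIV_compose_FDERIV[OF DERIV_real_sqrt[OF p] this]
  have "(r has_derivative (\<lambda>v. 2 * r y * ip (iv y) v * (inverse (r y) / 2))) (at y)"
    unfolding r_eq[symmetric] .
  moreover have "2 * r y * ip (iv y) v * (inverse (r y) / 2) = ip (iv y) v" for v
    using assms by simp
  ultimately show ?thesis by (simp only:)
qed

text \<open>Differentiating a normalised vector removes the component along that vector.\<close>

lemma has_derivative_iv:
  assumes "r y > 0"
  shows "(iv has_derivative (\<lambda>v. (1 / r y) *\<^sub>R (perp v - ip (iv y) v *\<^sub>R iv y))) (at y)"
proof -
  have 1: "((\<lambda>y. inverse (r y)) has_derivative (\<lambda>v. - (inverse (r y) * ip (iv y) v * inverse (r y)))) (at y)"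
    using assms Deriv.has_derivative_inverse[OF _ has_derivative_r] by simp
  have "((\<lambda>y. inverse (r y) *\<^sub>R perp y) has_derivative
      (\<lambda>v. inverse (r y) *\<^sub>R perp v + (- (inverse (r y) * ip (iv y) v * inverse (r y))) *\<^sub>R perp y)) (at y)"
    by (intro has_derivative_scaleR 1 bounded_linear.has_derivative[OF linear_perp] has_derivative_ident)
  moreover have "inverse (r y) *\<^sub>R perp v + (- (inverse (r y) * ip (iv y) v * inverse (r y))) *\<^sub>R perp y
      = (1 / r y) *\<^sub>R (perp v - ip (iv y) v *\<^sub>R iv y)" for v
    by (simp add: iv_eq scaleR_diff_right inverse_eq_divide)
  ultimately show ?thesis by (simp add: iv_eq[abs_def] inverse_eq_divide)
qed

lemma has_derivative_u:
  assumes "r y > 0" "b y > 0"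
  shows "(u has_derivative du y) (at y)"
proof -
  have "((\<lambda>y. r y / b y) has_derivative
      (\<lambda>v. (ip (iv y) v * b y - r y * b v) / (b y * b y))) (at y)"
    using assms by (intro has_derivative_divide' has_derivative_r b.has_derivative has_derivative_ident) auto
  moreover have "(ip (iv y) v * b y - r y * b v) / (b y * b y) = du y v" for v
    using assms by (simp add: du_def wt_fun_def field_simps)
  ultimately show ?thesis by (simp add: wt_fun_def[abs_def])
qed

text \<open>Lets functions of w and functions of u be exchanged at a fixed \<open>x\<close>; the
  factor b^2 cancels in the quotient.\<close>

lemma wv_eq:
  assumes "b y > 0" shows "wv y = sqrt ((u y)\<^sup>2 + 1 / c\<^sup>2 - 1)"
proof -
  have "y \<bullet> (a x *v y) - (b y)\<^sup>2 = (b y)\<^sup>2 * ((u y)\<^sup>2 + 1 / c\<^sup>2 - 1)"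
    using r_power2[of y] assms by (simp add: ip_def wt_fun_def power_divide algebra_simps)
  then show ?thesis using assms by (simp add: w_fun_def q_fun_def real_sqrt_mult)
qed

lemma inverse_c: "1 / c\<^sup>2 \<ge> 1"
  using c_pos c_less by (simp add: power_le_one)

lemma u_pos: "b y > 0 \<Longrightarrow> r y > 0 \<Longrightarrow> u y > 0"
  by (simp add: wt_fun_def)

lemma wv_power2: "b y > 0 \<Longrightarrow> (wv y)\<^sup>2 = (u y)\<^sup>2 + 1 / c\<^sup>2 - 1"
  unfolding wv_eq by (rule real_sqrt_pow2) (use inverse_c zero_le_power2[of "u y"] in linarith)

lemma u_eq:
  assumes "b y > 0" "r y > 0" shows "u y = sqrt ((wv y)\<^sup>2 + 1 - 1 / c\<^sup>2)"
  using u_pos[OF assms] wv_power2[OF assms(1)] by simp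

lemma wv_pos:
  assumes "b y > 0" "r y > 0" shows "wv y > 0"
proof -
  have "(u y)\<^sup>2 > 0" using u_pos[OF assms] by simp
  then have "(u y)\<^sup>2 + 1 / c\<^sup>2 - 1 > 0" using inverse_c by linarith
  then show ?thesis using wv_eq[OF assms(1)] by simp
qed

text \<open>The differential of \<Phi> - u \<Phi>1 is - u \<Phi>2 du, and b du is the form of
  \<open>iv\<close> minus u times \<open>b\<close>. Hence the terms with \<Phi>2 combine to b
  \<Phi>2 du^2; what remains is \<Phi>1 times the derivative of \<open>iv\<close>, which is K /
  r.\<close>

lemma fundamental_tensor_fs:
  assumes D: "open D" "y \<in> D" "\<And>z. z \<in> D \<Longrightarrow> b z > 0" "\<And>z. z \<in> D \<Longrightarrow> r z > 0"
    and F: "\<And>z. z \<in> D \<Longrightarrow> F x z = b z * \<Phi> (u z)"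
    and \<Phi>: "\<And>z. z \<in> D \<Longrightarrow> (\<Phi> has_real_derivative \<Phi>1 (u z)) (at (u z))"
    and \<Phi>1: "(\<Phi>1 has_real_derivative \<Phi>2) (at (u y))"
  defines "dF \<equiv> \<lambda>z v. (\<Phi> (u z) - u z * \<Phi>1 (u z)) * b v + \<Phi>1 (u z) * ip (iv z) v"
  shows "z \<in> D \<Longrightarrow> (F x has_derivative dF z) (at z)"
    and "fundamental_tensor F x y $ m $ n =
      dF y (axis m 1) * dF y (axis n 1)
      + F x y * (b y * \<Phi>2 * du y (axis m 1) * du y (axis n 1) + \<Phi>1 (u y) / r y * K y (axis m 1) (axis n 1))"
proof -
  show dF: "(F x has_derivative dF z) (at z)" if z: "z \<in> D" for z
  proof -
    note \<Phi>' = DERIV_compose_FDERIV[OF \<Phi>[OF z] has_derivative_u[OF D(4,3)[OF z]]]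
    have "((\<lambda>z. b z * \<Phi> (u z)) has_derivative (\<lambda>v. b z * (du z v * \<Phi>1 (u z)) + b v * \<Phi> (u z))) (at z)"
      by (intro has_derivative_mult \<Phi>' b.has_derivative has_derivative_ident)
    moreover have "b z * (du z v * \<Phi>1 (u z)) + b v * \<Phi> (u z) = dF z v" for v
    proof -
      have d: "b z * du z v = ip (iv z) v - u z * b v" using D(3)[OF z] by (simp add: du_def)
      have "b z * (du z v * \<Phi>1 (u z)) = (b z * du z v) * \<Phi>1 (u z)" by simp
      then show ?thesis unfolding d dF_def by (simp add: algebra_simps)
    qed
    ultimately have "((\<lambda>z. b z * \<Phi> (u z)) has_derivative dF z) (at z)" by simp
    then show ?thesis
      by (rule has_derivative_transform_within_open[OF _ D(1) z]) (simp add: F)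
  qed
  have pos: "b y > 0" "r y > 0" using D by auto
  note uy = has_derivative_u[OF pos(2,1)]
  have "((\<lambda>z. dF z v) has_derivative
      (\<lambda>w. b y * \<Phi>2 * du y w * du y v + \<Phi>1 (u y) / r y * K y w v)) (at y)" for v
  proof -
    note \<Phi>' = DERIV_compose_FDERIV[OF \<Phi>[OF D(2)] uy] DERIV_compose_FDERIV[OF \<Phi>1 uy]
    have K: "ip (perp w - ip (iv y) w *\<^sub>R iv y) v = K y w v" for w
      by (simp add: K_def ip.diff_left ip.scaleR_left ip_perp_perp ip_perp[of w v])
    have i: "((\<lambda>z. ip (iv z) v) has_derivative (\<lambda>w. K y w v / r y)) (at y)"
      using bounded_linear.has_derivative[OF ip.bounded_linear_left has_derivative_iv[OF pos(2)], of v]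
      by (simp add: ip.scaleR_left K)
    have d: "b y * du y v = ip (iv y) v - u y * b v" using pos by (simp add: du_def)
    have "(b y * \<Phi>2 * du y w * du y v + \<Phi>1 (u y) / r y * K y w v) =
      (du y w * \<Phi>1 (u y) - (u y * (du y w * \<Phi>2) + du y w * \<Phi>1 (u y))) * b v
      + (\<Phi>1 (u y) * (K y w v / r y) + (du y w * \<Phi>2) * ip (iv y) v)" for w
    proof -
      have "b y * \<Phi>2 * du y w * du y v = \<Phi>2 * du y w * (b y * du y v)" by simp
      then show ?thesis unfolding d by (simp add: algebra_simps)
    qed
    moreover have "((\<lambda>z. dF z v) has_derivative
      (\<lambda>w. (du y w * \<Phi>1 (u y) - (u y * (du y w * \<Phi>2) + du y w * \<Phi>1 (u y))) * b v
      + (\<Phi>1 (u y) * (K y w v / r y) + (du y w * \<Phi>2) * ip (iv y) v))) (at y)"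
      unfolding dF_def
      by (intro has_derivative_add has_derivative_mult_left has_derivative_mult has_derivative_diff \<Phi>' i uy)
    ultimately show ?thesis by (simp only:)
  qed
  note tensor = fundamental_tensor_eq[where F = F and x = x and dF = dF and
      d2F = "\<lambda>v w. b y * \<Phi>2 * du y w * du y v + \<Phi>1 (u y) / r y * K y w v", OF D(1,2) dF this]
  show "fundamental_tensor F x y $ m $ n =
      dF y (axis m 1) * dF y (axis n 1)
      + F x y * (b y * \<Phi>2 * du y (axis m 1) * du y (axis n 1) + \<Phi>1 (u y) / r y * K y (axis m 1) (axis n 1))"
    by (rule tensor)
qed

text \<open>Product rule, grouped into the radial part, the turning in the plane of
  \<open>iv y\<close> and \<open>e\<close>, and the motion of \<open>iv\<close> on its
  sphere.\<close>

lemma has_derivative_t: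
  assumes D: "open D" "y \<in> D" "b y > 0" "r y > 0"
    and t: "\<forall>z\<in>D. t z = (F z powr H) *\<^sub>R (\<sigma> (u z) *\<^sub>R iv z + \<kappa> (u z) *\<^sub>R e)"
    and F: "(F has_derivative dF) (at y)" "F y > 0"
    and \<sigma>: "(\<sigma> has_real_derivative \<sigma>') (at (u y))" and \<kappa>: "(\<kappa> has_real_derivative \<kappa>') (at (u y))"
  shows "(t has_derivative (\<lambda>v. (H * F y powr (H - 1) * dF v) *\<^sub>R (\<sigma> (u y) *\<^sub>R iv y + \<kappa> (u y) *\<^sub>R e)
    + F y powr H *\<^sub>R (du y v *\<^sub>R (\<sigma>' *\<^sub>R iv y + \<kappa>' *\<^sub>R e)
        + (\<sigma> (u y) / r y) *\<^sub>R (perp v - ip (iv y) v *\<^sub>R iv y)))) (at y)"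
proof -
  note uy = has_derivative_u[OF D(4,3)]
  note d = DERIV_compose_FDERIV[OF \<sigma> uy] DERIV_compose_FDERIV[OF \<kappa> uy]
  have p: "((\<lambda>z. F z powr H) has_derivative (\<lambda>v. H * F y powr (H - 1) * dF v)) (at y)"
    using DERIV_compose_FDERIV[OF has_real_derivative_powr[OF F(2), of H] F(1)] by (simp add: mult.commute)
  have "((\<lambda>z. (F z powr H) *\<^sub>R (\<sigma> (u z) *\<^sub>R iv z + \<kappa> (u z) *\<^sub>R e)) has_derivative
     (\<lambda>v. (H * F y powr (H - 1) * dF v) *\<^sub>R (\<sigma> (u y) *\<^sub>R iv y + \<kappa> (u y) *\<^sub>R e)
    + F y powr H *\<^sub>R (du y v *\<^sub>R (\<sigma>' *\<^sub>R iv y + \<kappa>' *\<^sub>R e)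
        + (\<sigma> (u y) / r y) *\<^sub>R (perp v - ip (iv y) v *\<^sub>R iv y)))) (at y)"
  proof -
    have "((\<lambda>z. (F z powr H) *\<^sub>R (\<sigma> (u z) *\<^sub>R iv z + \<kappa> (u z) *\<^sub>R e)) has_derivative
      (\<lambda>v. F y powr H *\<^sub>R ((\<sigma> (u y) *\<^sub>R ((1 / r y) *\<^sub>R (perp v - ip (iv y) v *\<^sub>R iv y)) + (du y v * \<sigma>') *\<^sub>R iv y)
        + (du y v * \<kappa>') *\<^sub>R e)
      + (H * F y powr (H - 1) * dF v) *\<^sub>R (\<sigma> (u y) *\<^sub>R iv y + \<kappa> (u y) *\<^sub>R e))) (at y)"
      by (intro has_derivative_scaleR has_derivative_add has_derivative_scaleR_left p d has_derivative_iv[OF D(4)])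
    then show ?thesis
      by (rule has_derivative_eq_rhs) (simp add: fun_eq_iff algebra_simps)
  qed
  then show ?thesis
    by (rule has_derivative_transform_within_open[OF _ D(1,2)]) (simp add: t)
qed

text \<open>The three parts of the derivative are mutually orthogonal: \<open>n\<close> is a unit
  vector, \<open>m\<close> is orthogonal to it because (\<sigma>, \<kappa>) moves on the unit
  circle, and \<open>d v\<close> is orthogonal to \<open>iv y\<close> and to \<open>e\<close>. The
  conformal factor is what turns the radial part into exactly dF^2.\<close>

lemma ip_t:
  fixes dF :: "real^'n \<Rightarrow> real"
  assumes "r y > 0" "F > 0" "H \<noteq> 0" "\<sigma>\<^sup>2 + \<kappa>\<^sup>2 = 1" "\<sigma> * \<sigma>' + \<kappa> * \<kappa>' = 0"
  defines "dt \<equiv> \<lambda>v. (H * F powr (H - 1) * dF v) *\<^sub>R (\<sigma> *\<^sub>R iv y + \<kappa> *\<^sub>R e)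
    + F powr H *\<^sub>R (du y v *\<^sub>R (\<sigma>' *\<^sub>R iv y + \<kappa>' *\<^sub>R e)
        + (\<sigma> / r y) *\<^sub>R (perp v - ip (iv y) v *\<^sub>R iv y))"
  shows "(1 / H * F powr (1 - H))\<^sup>2 * ip (dt v) (dt w) =
    dF v * dF w + F\<^sup>2 / H\<^sup>2 * ((\<sigma>'\<^sup>2 + \<kappa>'\<^sup>2) * du y v * du y w + \<sigma>\<^sup>2 / (r y)\<^sup>2 * K y v w)"
proof -
  define d where "d v = perp v - ip (iv y) v *\<^sub>R iv y" for v
  have d: "ip (d v) (d w) = K y v w" "ip (d v) (iv y) = 0" "ip (iv y) (d v) = 0" "ip (d v) e = 0" "ip e (d v) = 0"
    "ip e (iv y) = 0" for v w
    using ip_iv_iv[OF assms(1)] ip_iv_e ip_perp_e ip_iv_perp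
    by (auto simp: d_def K_def ip.diff_left ip.diff_right ip.scaleR_left ip.scaleR_right ip_flip)
  define n m where "n = \<sigma> *\<^sub>R iv y + \<kappa> *\<^sub>R e" and "m = \<sigma>' *\<^sub>R iv y + \<kappa>' *\<^sub>R e"
  have "ip n n = \<sigma>\<^sup>2 + \<kappa>\<^sup>2" "ip n m = \<sigma> * \<sigma>' + \<kappa> * \<kappa>'" "ip m n = \<sigma> * \<sigma>' + \<kappa> * \<kappa>'"
    unfolding n_def m_def
    by (simp_all add: ip.add_left ip.add_right ip.scaleR_left ip.scaleR_right d ip_iv_iv[OF assms(1)] ip_e_e ip_iv_e
        power2_eq_square mult.commute)
  then have nm: "ip n n = 1" "ip n m = 0" "ip m n = 0"
    by (simp_all only: assms(4,5))
  have nm': "ip m m = \<sigma>'\<^sup>2 + \<kappa>'\<^sup>2"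
      "ip n (d v) = 0" "ip m (d v) = 0" "ip (d v) n = 0" "ip (d v) m = 0" for v
    unfolding n_def m_def
    by (simp_all add: ip.add_left ip.add_right ip.scaleR_left ip.scaleR_right d ip_iv_iv[OF assms(1)] ip_e_e ip_iv_e
        power2_eq_square)
  have 1: "ip (\<alpha> *\<^sub>R n + \<gamma> *\<^sub>R (\<delta> *\<^sub>R m + s *\<^sub>R d v)) (\<alpha>' *\<^sub>R n + \<gamma> *\<^sub>R (\<delta>' *\<^sub>R m + s *\<^sub>R d w))
    = \<alpha> * \<alpha>' + \<gamma>\<^sup>2 * (\<delta> * \<delta>' * (\<sigma>'\<^sup>2 + \<kappa>'\<^sup>2) + s\<^sup>2 * K y v w)" for \<alpha> \<alpha>' \<gamma> \<delta> \<delta>' s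
    by (simp only: ip.add_left ip.add_right ip.scaleR_left ip.scaleR_right d nm nm') (simp add: power2_eq_square algebra_simps)
  have 2: "F powr (1 - H) * F powr (H - 1) = 1" "F powr (1 - H) * F powr H = F"
    using assms(2) by (simp_all flip: powr_add)
  \<comment> \<open>\<open>P\<close>, \<open>Q\<close>, \<open>R\<close> stand for the three powers
    of \<open>F\<close>; the exponents then enter only through the two products in
    \<open>2\<close>.\<close>
  have 3: "(h * P)\<^sup>2 * (H * Q * f * (H * Q * g) + R\<^sup>2 * Z) = (P * Q)\<^sup>2 * (f * g) + (P * R)\<^sup>2 * h\<^sup>2 * Z"
    if "h * H = 1" for h P Q R f g Z
  proof -
    have "(h * P)\<^sup>2 * (H * Q * f * (H * Q * g) + R\<^sup>2 * Z) = (h * H)\<^sup>2 * ((P * Q)\<^sup>2 * (f * g)) + (P * R)\<^sup>2 * h\<^sup>2 * Z"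
      by (simp add: power2_eq_square algebra_simps)
    then show ?thesis using that by simp
  qed
  have h: "1 / H * H = 1" using assms(3) by simp
  show ?thesis
    unfolding dt_def d_def[symmetric] n_def[symmetric] m_def[symmetric] 1 3[OF h] 2
    by (simp add: power_divide mult_ac)
qed

section \<open>Cramer's rule and behaviour under scaling\<close>

lemma det_a: "det (a x) \<noteq> 0"
  using invertible_a invertible_det_nz by blast

text \<open>In this form the smoothness of \<open>B\<close> in the base point can be read off from
  the determinants.\<close>

lemma B_eq: "B = (\<chi> k. det (\<chi> i j. if j = k then \<beta> x $ i else a x $ i $ j) / det (a x))"
  using cramer[OF det_a, of B "\<beta> x"] a_B by simp

lemma c_power2: "c\<^sup>2 = \<beta> x \<bullet> B"
  using b_B by (simp add: one_form_def)

lemma r_scale: "k > 0 \<Longrightarrow> r (k *\<^sub>R y) = k * r y"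
proof -
  assume k: "k > 0"
  have "ip (k *\<^sub>R y) (k *\<^sub>R y) - (b (k *\<^sub>R y))\<^sup>2 / c\<^sup>2 = k\<^sup>2 * (ip y y - (b y)\<^sup>2 / c\<^sup>2)"
    by (simp add: ip.scaleR_left ip.scaleR_right b.scaleR power2_eq_square algebra_simps)
  then show ?thesis using k by (simp add: r_eq real_sqrt_mult)
qed

lemma wv_scale: "k > 0 \<Longrightarrow> wv (k *\<^sub>R y) = wv y"
proof -
  assume k: "k > 0"
  have "k *\<^sub>R y \<bullet> (a x *v (k *\<^sub>R y)) - (b (k *\<^sub>R y))\<^sup>2 = k\<^sup>2 * (y \<bullet> (a x *v y) - (b y)\<^sup>2)"
    by (simp add: matrix_vector_mult_scaleR b.scaleR power2_eq_square algebra_simps)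
  then have "q_fun a \<beta> x (k *\<^sub>R y) = k * q_fun a \<beta> x y"
    using k by (simp add: q_fun_def real_sqrt_mult)
  then show ?thesis using k by (simp add: w_fun_def b.scaleR)
qed

lemma perp_scale: "perp (k *\<^sub>R y) = k *\<^sub>R perp y"
  by (simp add: perp_def b.scaleR scaleR_diff_right)

lemma iv_scale: "k > 0 \<Longrightarrow> iv (k *\<^sub>R y) = iv y"
  by (simp add: iv_eq r_scale perp_scale)

end

section \<open>The ordinary differential equation\<close>

text \<open>Necessity on one fiber: \<open>A\<close> compares the coefficients of du^2, and
  \<open>B\<close> those of the metric on the directions. The quantity to follow is Z = u \<kappa> /
  \<sigma>, u times the cotangent of the polar angle.\<close>

lemma tau_of_conformal:
  fixes \<Phi> \<sigma> \<kappa> :: "real \<Rightarrow> real"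
  assumes I: "open I" "connected I" "I \<noteq> {}" "\<And>u. u \<in> I \<Longrightarrow> u > 0"
    and sm: "smooth_on \<Phi> I" "smooth_on \<sigma> I" "smooth_on \<kappa> I"
    and \<Phi>: "\<And>u. u \<in> I \<Longrightarrow> \<Phi> u > 0" and \<sigma>: "\<And>u. u \<in> I \<Longrightarrow> \<sigma> u > 0"
    and unit: "\<And>u. u \<in> I \<Longrightarrow> (\<sigma> u)\<^sup>2 + (\<kappa> u)\<^sup>2 = 1"
    and "H > 0"
    and A: "\<And>u. u \<in> I \<Longrightarrow> H\<^sup>2 * deriv (deriv \<Phi>) u = \<Phi> u * ((deriv \<sigma> u)\<^sup>2 + (deriv \<kappa> u)\<^sup>2)"
    and B: "\<And>u. u \<in> I \<Longrightarrow> H\<^sup>2 * (u * deriv \<Phi> u) = \<Phi> u * (\<sigma> u)\<^sup>2"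
  shows "H \<le> 1"
    and "\<exists>C. \<forall>u\<in>I. u * \<Phi> u / deriv \<Phi> u = C\<^sup>2 + 2 * C * sqrt (1 - H\<^sup>2) * u + u\<^sup>2"
proof -
  define D where "D u = deriv \<kappa> u * \<sigma> u - \<kappa> u * deriv \<sigma> u" for u
  define Z where "Z u = u * \<kappa> u / \<sigma> u" for u
  define Z' where "Z' u = (\<sigma> u * \<kappa> u + u * D u) / (\<sigma> u)\<^sup>2" for u
  note d = smooth_on_real_has_deriv[OF sm(1)] smooth_on_real_has_deriv[OF sm(2)]
    smooth_on_real_has_deriv[OF sm(3)] smooth_on_real_has_deriv[OF smooth_on_deriv[OF I(1) sm(1)]]
  have Z: "(Z has_real_derivative Z' u) (at u)" if u: "u \<in> I" for u
  proof -
    have "((\<lambda>u. u * \<kappa> u / \<sigma> u) has_real_derivative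
        ((u * deriv \<kappa> u + 1 * \<kappa> u) * \<sigma> u - u * \<kappa> u * deriv \<sigma> u) / (\<sigma> u * \<sigma> u)) (at u)"
      using \<sigma>[OF u] by (intro DERIV_divide DERIV_mult' DERIV_ident d u) auto
    then show ?thesis
      by (simp add: Z_def[abs_def] Z'_def D_def power2_eq_square algebra_simps)
  qed
  have perp: "\<sigma> u * deriv \<sigma> u + \<kappa> u * deriv \<kappa> u = 0" if u: "u \<in> I" for u
  proof -
    have "((\<lambda>u. (\<sigma> u)\<^sup>2 + (\<kappa> u)\<^sup>2) has_real_derivative
        2 * (\<sigma> u * deriv \<sigma> u + \<kappa> u * deriv \<kappa> u)) (at u)"
      by (rule derivative_eq_intros d u refl | simp)+
    then have "((\<lambda>u. 1) has_real_derivative 2 * (\<sigma> u * deriv \<sigma> u + \<kappa> u * deriv \<kappa> u)) (at u)"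
      by (rule has_field_derivative_transform_within_open[OF _ I(1) u]) (simp add: unit)
    from DERIV_unique[OF this DERIV_const] show ?thesis by simp
  qed
  have Z'_sq: "(Z' u)\<^sup>2 = 1 / H\<^sup>2 - 1" if u: "u \<in> I" for u
  proof -
    define s k s1 k1 f f1 f2 where defs: "s = \<sigma> u" "k = \<kappa> u" "s1 = deriv \<sigma> u" "k1 = deriv \<kappa> u"
      "f = \<Phi> u" "f1 = deriv \<Phi> u" "f2 = deriv (deriv \<Phi>) u"
    have "((\<lambda>u. H\<^sup>2 * (u * deriv \<Phi> u)) has_real_derivative H\<^sup>2 * (u * f2 + f1)) (at u)"
      unfolding defs by (rule derivative_eq_intros d u refl | simp)+
    moreover have "((\<lambda>u. \<Phi> u * (\<sigma> u)\<^sup>2) has_real_derivative f1 * s\<^sup>2 + f * (2 * s * s1)) (at u)"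
      unfolding defs by (rule derivative_eq_intros d u refl | simp)+
    then have "((\<lambda>u. H\<^sup>2 * (u * deriv \<Phi> u)) has_real_derivative f1 * s\<^sup>2 + f * (2 * s * s1)) (at u)"
      by (rule has_field_derivative_transform_within_open[OF _ I(1) u]) (simp add: B)
    ultimately have B': "H\<^sup>2 * (u * f2 + f1) = f1 * s\<^sup>2 + f * (2 * s * s1)"
      by (rule DERIV_unique)
    have eqs: "s\<^sup>2 + k\<^sup>2 = 1" "s * s1 + k * k1 = 0" "H\<^sup>2 * f2 = f * (s1\<^sup>2 + k1\<^sup>2)" "H\<^sup>2 * (u * f1) = f * s\<^sup>2"
      using unit[OF u] perp[OF u] A[OF u] B[OF u] by (simp_all add: defs)
    have pos: "f > 0" "s > 0" using \<Phi>[OF u] \<sigma>[OF u] by (simp_all add: defs)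
    \<comment> \<open>The derivative of a unit vector is orthogonal to it: (s1, k1) is D' times the
      rotated vector (-k, s).\<close>
    define D' where "D' = k1 * s - k * s1"
    have s1: "s1 = - (k * D')" and k1: "k1 = s * D'"
      using eqs(1,2) unfolding D'_def by algebra+
    have f2: "H\<^sup>2 * f2 = f * D'\<^sup>2" using eqs(1,3) unfolding s1 k1 by algebra
    \<comment> \<open>This is \<open>B'\<close> times H^2 u, with f1 and f2 replaced by means of
      \<open>B\<close> and \<open>A\<close>; the square is completed through s^2 = s^2 k^2 +
      s^4.\<close>
    have "f * (H\<^sup>2 * (u * D' + s * k)\<^sup>2) = f * (s ^ 4 * (1 - H\<^sup>2))"
      using B' f2 eqs(1,4) unfolding s1 by algebra
    then have "H\<^sup>2 * (u * D' + s * k)\<^sup>2 = s ^ 4 * (1 - H\<^sup>2)" using pos by simp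
    moreover have "Z' u = (u * D' + s * k) / s\<^sup>2"
      by (simp add: Z'_def D_def D'_def defs add.commute)
    then have "(u * D' + s * k)\<^sup>2 = (Z' u)\<^sup>2 * s ^ 4"
      using pos by (simp add: power_divide flip: power_mult)
    ultimately have "H\<^sup>2 * (Z' u)\<^sup>2 = 1 - H\<^sup>2" using pos by simp
    then show ?thesis using \<open>H > 0\<close> by (simp add: field_simps)
  qed
  from I(3) obtain u0 where "u0 \<in> I" by blast
  from Z'_sq[OF this] have "1 / H\<^sup>2 - 1 \<ge> 0" using zero_le_power2[of "Z' u0"] by linarith
  then have "H\<^sup>2 \<le> 1" using \<open>H > 0\<close> by (simp add: le_divide_eq)
  then show H1: "H \<le> 1" using power2_le_imp_le[of H 1] by simp
  \<comment> \<open>A continuous function with values in {K, -K} on a connected set is constant; so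
    Z' is constant and Z is affine.\<close>
  define K where "K = sqrt (1 / H\<^sup>2 - 1)"
  have "Z' ` I \<subseteq> {K, - K}"
  proof -
    have "Z' u = K \<or> Z' u = - K" if "u \<in> I" for u
    proof -
      have "(Z' u)\<^sup>2 = K\<^sup>2"
        unfolding Z'_sq[OF that] K_def using \<open>1 / H\<^sup>2 - 1 \<ge> 0\<close> by simp
      then show ?thesis by (simp add: power2_eq_iff)
    qed
    then show ?thesis by blast
  qed
  moreover have "continuous_on I Z'"
  proof -
    have "continuous_on I (deriv \<sigma>)" "continuous_on I (deriv \<kappa>)" "continuous_on I \<sigma>" "continuous_on I \<kappa>"
      by (intro smooth_on_imp_continuous_on smooth_on_deriv I(1) sm)+
    moreover have "\<forall>u\<in>I. (\<sigma> u)\<^sup>2 \<noteq> 0"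
      using \<sigma> by (metis less_irrefl power_not_zero)
    ultimately show ?thesis
      unfolding Z'_def[abs_def] D_def[abs_def] by (intro continuous_intros)
  qed
  ultimately have "Z' constant_on I"
    using continuous_finite_range_constant[OF I(2)] by (meson finite.emptyI finite_insert finite_subset)
  then obtain K' where K': "\<And>u. u \<in> I \<Longrightarrow> Z' u = K'"
    unfolding constant_on_def by blast
  have K'_sq: "K'\<^sup>2 = 1 / H\<^sup>2 - 1" using Z'_sq[OF \<open>u0 \<in> I\<close>] K'[OF \<open>u0 \<in> I\<close>] by simp
  have "((\<lambda>u. Z u - K' * u) has_real_derivative 0) (at u)" if u: "u \<in> I" for u
    using DERIV_diff[OF Z[OF u] DERIV_cmult_Id[of K']] K'[OF u] by simp
  then have "(\<lambda>u. Z u - K' * u) constant_on I"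
    by (rule has_field_derivative_0_imp_constant_on[OF _ I(2,1)])
  then obtain A where "\<And>u. u \<in> I \<Longrightarrow> Z u - K' * u = A"
    unfolding constant_on_def by blast
  then have A: "Z u = A + K' * u" if "u \<in> I" for u
    using that by (simp add: diff_eq_eq)
  \<comment> \<open>The root in the claim is nonnegative while \<open>K'\<close> may have either
    sign; the sign of C is chosen so that C sqrt(1 - H^2) = H^2 A K'.\<close>
  define C where "C = (if K' \<ge> 0 then H * A else - (H * A))"
  have "K' = (if K' \<ge> 0 then sqrt (1 - H\<^sup>2) / H else - (sqrt (1 - H\<^sup>2) / H))"
  proof -
    have "K'\<^sup>2 = (1 - H\<^sup>2) / H\<^sup>2"
      unfolding K'_sq using \<open>H > 0\<close> by (simp add: diff_divide_distrib)
    then have "\<bar>K'\<bar> = sqrt ((1 - H\<^sup>2) / H\<^sup>2)"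
      by (simp flip: real_sqrt_abs)
    also have "\<dots> = sqrt (1 - H\<^sup>2) / H" using \<open>H > 0\<close> by (simp add: real_sqrt_divide)
    finally show ?thesis by auto
  qed
  then have CK: "C * sqrt (1 - H\<^sup>2) = H\<^sup>2 * A * K'"
    using \<open>H > 0\<close> unfolding C_def by (cases "K' \<ge> 0") (auto simp: power2_eq_square field_simps)
  have C2: "C\<^sup>2 = H\<^sup>2 * A\<^sup>2" by (simp add: C_def power_mult_distrib)
  have "u * \<Phi> u / deriv \<Phi> u = C\<^sup>2 + 2 * C * sqrt (1 - H\<^sup>2) * u + u\<^sup>2" if u: "u \<in> I" for u
  proof -
    note pos = \<Phi>[OF u] \<sigma>[OF u] I(4)[OF u]
    have "H\<^sup>2 * (u * deriv \<Phi> u) > 0" unfolding B[OF u] using pos by simp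
    then have nz: "deriv \<Phi> u \<noteq> 0" by auto
    \<comment> \<open>\<open>B\<close> expresses the quotient through \<sigma>; inserting 1 =
      \<sigma>^2 + \<kappa>^2 then yields H^2 (u^2 + Z^2), and Z is affine.\<close>
    have "u * \<Phi> u / deriv \<Phi> u = H\<^sup>2 * u\<^sup>2 / (\<sigma> u)\<^sup>2"
      using B[OF u] pos nz by (simp add: field_simps power2_eq_square)
    also have "\<dots> = H\<^sup>2 * u\<^sup>2 * ((\<sigma> u)\<^sup>2 + (\<kappa> u)\<^sup>2) / (\<sigma> u)\<^sup>2" by (simp add: unit[OF u])
    also have "\<dots> = H\<^sup>2 * (u\<^sup>2 + (Z u)\<^sup>2)"
      using pos by (simp add: Z_def power_divide power_mult_distrib field_simps)
    also have "\<dots> = H\<^sup>2 * A\<^sup>2 + 2 * (H\<^sup>2 * A * K') * u + H\<^sup>2 * (1 + K'\<^sup>2) * u\<^sup>2"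
      unfolding A[OF u] by (simp add: power2_eq_square algebra_simps)
    also have "H\<^sup>2 * (1 + K'\<^sup>2) = 1" unfolding K'_sq using \<open>H > 0\<close> by simp
    finally show ?thesis unfolding C2 CK[symmetric] by simp
  qed
  then show "\<exists>C. \<forall>u\<in>I. u * \<Phi> u / deriv \<Phi> u = C\<^sup>2 + 2 * C * sqrt (1 - H\<^sup>2) * u + u\<^sup>2" by blast
qed

text \<open>Sufficiency on one fiber, with X the cotangent of the polar angle. The factor sgn C
  makes X depend on C through C^2 and C sqrt(1 - H^2) only; these are coefficients of \<tau>, so X
  can be expressed by \<tau>.\<close>

lemma conformal_of_tau:
  fixes \<Phi> \<sigma> \<kappa> X :: "real \<Rightarrow> real"
  assumes I: "open I" "u \<in> I" "\<And>u. u \<in> I \<Longrightarrow> u > 0"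
    and sm: "smooth_on \<Phi> I"
    and \<Phi>: "\<And>u. u \<in> I \<Longrightarrow> \<Phi> u > 0"
    and H: "H > 0" "H \<le> 1"
    and \<tau>: "\<And>u. u \<in> I \<Longrightarrow> u * \<Phi> u / deriv \<Phi> u = C\<^sup>2 + 2 * C * sqrt (1 - H\<^sup>2) * u + u\<^sup>2"
    and "C \<noteq> 0"
    and X: "\<And>u. u \<in> I \<Longrightarrow> H * u * X u = \<bar>C\<bar> + sgn C * sqrt (1 - H\<^sup>2) * u"
    and \<sigma>: "\<And>u. u \<in> I \<Longrightarrow> \<sigma> u = 1 / sqrt (1 + (X u)\<^sup>2)"
    and \<kappa>: "\<And>u. u \<in> I \<Longrightarrow> \<kappa> u = X u / sqrt (1 + (X u)\<^sup>2)"
  shows "H\<^sup>2 * (u * deriv \<Phi> u) = \<Phi> u * (\<sigma> u)\<^sup>2"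
    and "H\<^sup>2 * deriv (deriv \<Phi>) u = \<Phi> u * ((deriv \<sigma> u)\<^sup>2 + (deriv \<kappa> u)\<^sup>2)"
proof -
  define R where "R = sqrt (1 - H\<^sup>2)"
  define T where "T u = C\<^sup>2 + 2 * C * R * u + u\<^sup>2" for u
  have R: "R\<^sup>2 = 1 - H\<^sup>2" using H by (simp add: R_def power_le_one)
  have S: "1 + (X u)\<^sup>2 > 0" for u by (smt (verit) zero_le_power2)
  have sgnC: "(sgn C)\<^sup>2 = 1" "\<bar>C\<bar> * sgn C = C" using \<open>C \<noteq> 0\<close> by (auto simp: sgn_if abs_if)
  have T: "H\<^sup>2 * u\<^sup>2 * (1 + (X u)\<^sup>2) = T u" if u: "u \<in> I" for u
  proof -
    have "H\<^sup>2 * u\<^sup>2 * (1 + (X u)\<^sup>2) = H\<^sup>2 * u\<^sup>2 + (H * u * X u)\<^sup>2"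
      by (simp add: power_mult_distrib algebra_simps)
    also have "\<dots> = H\<^sup>2 * u\<^sup>2 + (\<bar>C\<bar>\<^sup>2 + 2 * (\<bar>C\<bar> * sgn C) * R * u + (sgn C)\<^sup>2 * R\<^sup>2 * u\<^sup>2)"
      unfolding X[OF u] R_def[symmetric] by (simp add: power2_sum power_mult_distrib)
    also have "\<dots> = T u" unfolding sgnC R T_def by (simp add: algebra_simps)
    finally show ?thesis .
  qed
  have Tpos: "T u > 0" if u: "u \<in> I" for u
    unfolding T[OF u, symmetric] using H(1) I(3)[OF u] S[of u] by simp
  \<comment> \<open>A vanishing derivative would make the quotient in \<open>\<tau>\<close> equal to
    0, by the convention for division, whereas T is positive.\<close>
  have \<Phi>1: "deriv \<Phi> u = \<Phi> u * u / T u" if u: "u \<in> I" for u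
    using \<tau>[OF u] Tpos[OF u] I(3)[OF u] \<Phi>[OF u]
    unfolding R_def[symmetric] T_def[symmetric] by (cases "deriv \<Phi> u = 0") (auto simp: field_simps)
  note u = I(2) and pos = I(3)[OF I(2)] \<Phi>[OF I(2)] Tpos[OF I(2)]
  have \<sigma>2: "(\<sigma> u)\<^sup>2 = H\<^sup>2 * u\<^sup>2 / T u"
    unfolding \<sigma>[OF u] T[OF u, symmetric] using S[of u] pos H(1) by (simp add: power_divide)
  show "H\<^sup>2 * (u * deriv \<Phi> u) = \<Phi> u * (\<sigma> u)\<^sup>2"
    unfolding \<sigma>2 \<Phi>1[OF u] by (simp add: power2_eq_square)
  have "((\<lambda>u. \<Phi> u * u / T u) has_real_derivative \<Phi> u * C\<^sup>2 / (T u)\<^sup>2) (at u)"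
  proof -
    have "(T has_real_derivative 2 * C * R + 2 * u) (at u)"
      unfolding T_def[abs_def] by (rule derivative_eq_intros refl | simp)+
    then have "((\<lambda>u. \<Phi> u * u / T u) has_real_derivative
       ((\<Phi> u * 1 + deriv \<Phi> u * u) * T u - \<Phi> u * u * (2 * C * R + 2 * u)) / (T u * T u)) (at u)"
      using pos by (intro DERIV_divide DERIV_mult' DERIV_ident smooth_on_real_has_deriv[OF sm u]) auto
    \<comment> \<open>Once deriv \<Phi> times T is replaced by \<Phi> u, the remaining factor is T -
      2 C R u - u^2 = C^2.\<close>
    moreover have "(\<Phi> u * 1 + deriv \<Phi> u * u) * T u - \<Phi> u * u * (2 * C * R + 2 * u) = \<Phi> u * C\<^sup>2"
    proof -
      have "deriv \<Phi> u * T u = \<Phi> u * u" using \<Phi>1[OF u] pos by simp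
      then have "(\<Phi> u * 1 + deriv \<Phi> u * u) * T u = \<Phi> u * (T u + u * u)" by (simp add: algebra_simps)
      then show ?thesis by (simp add: T_def power2_eq_square algebra_simps)
    qed
    ultimately show ?thesis by (simp add: power2_eq_square)
  qed
  then have "(deriv \<Phi> has_real_derivative \<Phi> u * C\<^sup>2 / (T u)\<^sup>2) (at u)"
    by (rule has_field_derivative_transform_within_open[OF _ I(1) u]) (simp add: \<Phi>1)
  then have \<Phi>2: "deriv (deriv \<Phi>) u = \<Phi> u * C\<^sup>2 / (T u)\<^sup>2" by (rule DERIV_imp_deriv)
  \<comment> \<open>X is |C| / (H u) plus a constant, and the constant is lost on
    differentiation.\<close>
  define X' where "X' = - (\<bar>C\<bar> / (H * u\<^sup>2))"
  have "((\<lambda>u. (\<bar>C\<bar> / H) * inverse u + sgn C * R / H) has_real_derivative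
      (\<bar>C\<bar> / H) * - (inverse u ^ Suc (Suc 0)) + 0) (at u)"
    using pos by (intro DERIV_add DERIV_const DERIV_cmult DERIV_inverse) auto
  then have "((\<lambda>u. (\<bar>C\<bar> / H) * inverse u + sgn C * R / H) has_real_derivative X') (at u)"
    by (simp add: X'_def power2_eq_square inverse_eq_divide)
  then have X': "(X has_real_derivative X') (at u)"
  proof (rule has_field_derivative_transform_within_open[OF _ I(1) u])
    fix v assume v: "v \<in> I"
    show "(\<bar>C\<bar> / H) * inverse v + sgn C * R / H = X v"
      using X[OF v] I(3)[OF v] H(1) by (simp add: R_def field_simps)
  qed
  define q where "q = sqrt (1 + (X u)\<^sup>2)"
  have q: "q > 0" "q\<^sup>2 = 1 + (X u)\<^sup>2" using S[of u] by (simp_all add: q_def)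
  have s: "((\<lambda>u. sqrt (1 + (X u)\<^sup>2)) has_real_derivative X u * X' / q) (at u)"
    using S[of u] q(1) unfolding q_def
    by (auto intro!: derivative_eq_intros X' simp: field_simps)
  have "((\<lambda>u. 1 / sqrt (1 + (X u)\<^sup>2)) has_real_derivative (0 * q - 1 * (X u * X' / q)) / (q * q)) (at u)"
    using q(1) DERIV_divide[OF DERIV_const s, of 1] by (simp add: q_def)
  then have "(\<sigma> has_real_derivative (0 * q - 1 * (X u * X' / q)) / (q * q)) (at u)"
    by (rule has_field_derivative_transform_within_open[OF _ I(1) u]) (simp add: \<sigma>)
  then have \<sigma>': "deriv \<sigma> u = - (X u * X' / q ^ 3)"
    using DERIV_imp_deriv q(1) by (fastforce simp: power3_eq_cube)
  have "((\<lambda>u. X u / sqrt (1 + (X u)\<^sup>2)) has_real_derivative (X' * q - X u * (X u * X' / q)) / (q * q)) (at u)"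
    using q(1) DERIV_divide[OF X' s] by (simp add: q_def)
  then have "(\<kappa> has_real_derivative (X' * q - X u * (X u * X' / q)) / (q * q)) (at u)"
    by (rule has_field_derivative_transform_within_open[OF _ I(1) u]) (simp add: \<kappa>)
  moreover have "(X' * q - X u * (X u * X' / q)) / (q * q) = X' / q ^ 3"
  proof -
    have "X' * q - X u * (X u * X' / q) = X' * (q\<^sup>2 - (X u)\<^sup>2) / q"
      using q(1) by (simp add: field_simps power2_eq_square)
    also have "\<dots> = X' / q" by (simp add: q(2))
    finally show ?thesis using q(1) by (simp add: power3_eq_cube)
  qed
  ultimately have \<kappa>': "deriv \<kappa> u = X' / q ^ 3" using DERIV_imp_deriv by fastforce
  \<comment> \<open>The speed of (\<sigma>, \<kappa>) on the unit circle is that of the angle arccot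
    X, whose derivative has the square X'^2 / (1 + X^2)^2.\<close>
  have "(deriv \<sigma> u)\<^sup>2 + (deriv \<kappa> u)\<^sup>2 = X'\<^sup>2 * (1 + (X u)\<^sup>2) / (q ^ 3)\<^sup>2"
    unfolding \<sigma>' \<kappa>' by (simp add: power_divide power_mult_distrib add_divide_distrib algebra_simps)
  also have "\<dots> = X'\<^sup>2 / (1 + (X u)\<^sup>2)\<^sup>2"
    unfolding q(2)[symmetric] using q(1) by (simp add: power2_eq_square power3_eq_cube)
  also have "1 + (X u)\<^sup>2 = T u / (H\<^sup>2 * u\<^sup>2)"
    using T[OF u] pos H(1) by (simp add: field_simps)
  also have "X'\<^sup>2 / (T u / (H\<^sup>2 * u\<^sup>2))\<^sup>2 = H\<^sup>2 * (C\<^sup>2 / (T u)\<^sup>2)"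
    unfolding X'_def using pos H(1) by (simp add: power_divide power_mult_distrib field_simps)
  finally show "H\<^sup>2 * deriv (deriv \<Phi>) u = \<Phi> u * ((deriv \<sigma> u)\<^sup>2 + (deriv \<kappa> u)\<^sup>2)"
    unfolding \<Phi>2 by simp
qed

section \<open>Conformality on a single tangent space\<close>

text \<open>Bilinear forms are determined on basis vectors; this turns identities between components
  into identities for arbitrary vectors.\<close>

lemma matrix_form_eq:
  fixes G :: "real^'n^'n"
  assumes f: "bilinear f" and G: "\<And>m n. G $ m $ n = f (axis m 1) (axis n 1)"
  shows "v \<bullet> (G *v w) = f v w"
proof -
  have "bilinear (\<lambda>v w. v \<bullet> (G *v w))"
    by (simp add: bilinear_def linear_iff inner_add_left inner_add_right matrix_vector_right_distrib
        matrix_vector_mult_scaleR)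
  moreover have "i \<bullet> (G *v j) = f i j" if "i \<in> Basis" "j \<in> Basis" for i j :: "real^'n"
    using that by (auto simp: Basis_vec_def G inner_axis' matrix_vector_mult_basis column_def)
  ultimately have "(\<lambda>v w. v \<bullet> (G *v w)) = f"
    by (intro bilinear_eq_stdbasis f)
  then show ?thesis by metis
qed

context fs_point
begin

lemma K_eq: "K y v w = ip v w - b v * b w / c\<^sup>2 - ip (iv y) v * ip (iv y) w"
  by (simp add: K_def ip_perp_perp)

lemma bilinear_du_K: "bilinear (\<lambda>v w. \<alpha> * (du y v * du y w) + \<gamma> * K y v w)"
proof -
  have 1: "du y (v + w) = du y v + du y w" "du y (k *\<^sub>R v) = k * du y v" for v w k
    by (simp_all add: du_def ip.add_right ip.scaleR_right b.add b.scaleR add_divide_distrib diff_divide_distrib algebra_simps)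
  have 2: "K y (v + v') w = K y v w + K y v' w" "K y w (v + v') = K y w v + K y w v'"
     "K y (k *\<^sub>R v) w = k * K y v w" "K y w (k *\<^sub>R v) = k * K y w v" for v v' w k
    by (simp_all add: K_eq ip.add_right ip.scaleR_right ip.add_left ip.scaleR_left b.add b.scaleR
        add_divide_distrib diff_divide_distrib algebra_simps)
  show ?thesis by (simp add: bilinear_def linear_iff 1 2 algebra_simps)
qed

lemma b_e: "b e = c"
  using c_pos by (simp add: b_up_unit_def b.scaleR b_B power2_eq_square)

lemma K_e: "K y e e = 0"
  using c_pos by (simp add: K_eq ip_e_e ip_iv_e b_e power2_eq_square)

lemma du_e: "du y e = - (u y * c / b y)"
  by (simp add: du_def ip_iv_e b_e)

text \<open>Two linear conditions leave a nonzero vector once N \<ge> 3; on the common kernel of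
  \<open>b\<close> and \<open>ip (iv y)\<close> the form K coincides with \<open>ip\<close>.\<close>

lemma ex_transversal:
  assumes "CARD('n) \<ge> 3"
  obtains v where "v \<noteq> 0" "du y v = 0" "K y v v > 0"
proof -
  have "dim {\<beta> x, a x *v iv y} \<le> card {\<beta> x, a x *v iv y}"
    by (rule dim_le_card') simp
  also have "\<dots> \<le> 2" by (simp add: card_insert_if)
  finally have "dim {\<beta> x, a x *v iv y} < DIM(real^'n)" using assms by simp
  from orthogonal_to_subspace_exists[OF this] obtain v where
    v: "v \<noteq> 0" "\<And>w. w \<in> span {\<beta> x, a x *v iv y} \<Longrightarrow> orthogonal v w" by blast
  have "b v = 0" using v(2)[of "\<beta> x"] by (simp add: span_base orthogonal_def one_form_def inner_commute)
  moreover have "ip (iv y) v = 0"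
    using v(2)[of "a x *v iv y"] by (subst ip_commute) (simp add: span_base orthogonal_def ip_def)
  ultimately show ?thesis using that[OF v(1)] ip_pos[OF v(1)] by (simp add: du_def K_eq)
qed

text \<open>Linear independence of du^2 and K: \<open>e\<close> annihilates K but not du, and a
  transversal vector annihilates du but not K. This is where N \<ge> 3 enters.\<close>

lemma du_K_zero:
  assumes "CARD('n) \<ge> 3" "b y > 0" "r y > 0"
    and zero: "\<And>m n. \<alpha> * (du y (axis m 1) * du y (axis n 1)) + \<gamma> * K y (axis m 1) (axis n 1) = 0"
  shows "\<alpha> = 0" "\<gamma> = 0"
proof -
  \<comment> \<open>The vanishing components say that the zero matrix represents the form.\<close>
  have "(v::real^'n) \<bullet> (0 *v w) = \<alpha> * (du y v * du y w) + \<gamma> * K y v w" for v w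
    by (rule matrix_form_eq[OF bilinear_du_K]) (simp add: zero)
  then have all: "\<alpha> * (du y v * du y w) + \<gamma> * K y v w = 0" for v w
    by simp
  have "du y e \<noteq> 0" using u_pos[OF assms(2,3)] c_pos assms(2) by (simp add: du_e)
  then show "\<alpha> = 0" using all[of e e] by (simp add: K_e)
  obtain v where "v \<noteq> 0" "du y v = 0" "K y v v > 0" using ex_transversal[OF assms(1)] .
  then show "\<gamma> = 0" using all[of v v] by simp
qed

lemma sum_jacobian:
  assumes "(f has_derivative f') (at y)"
  shows "(\<Sum>i\<in>UNIV. \<Sum>j\<in>UNIV. a x $ i $ j * jacobian f (at y) $ i $ m * jacobian f (at y) $ j $ n)
    = ip (f' (axis m 1)) (f' (axis n 1))"
proof -
  have "jacobian f (at y) $ i $ k = f' (axis k 1) $ i" for i k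
    by (simp add: jacobian_def matrix_def flip: frechet_derivative_at[OF assms])
  then show ?thesis
    by (simp add: ip_def inner_vec_def matrix_vector_mult_def sum_distrib_left mult_ac)
qed

end

section \<open>A metric of the form b \<Phi>(u) on one fiber\<close>

locale fs_fiber = fs_point a \<beta> x
  for a :: "real^'n \<Rightarrow> real^'n^'n" and \<beta> x +
  fixes F :: "real^'n \<Rightarrow> real^'n \<Rightarrow> real" and D :: "(real^'n) set"
    and I :: "real set" and \<Phi> :: "real \<Rightarrow> real"
  assumes open_D: "open D" and b_pos: "y \<in> D \<Longrightarrow> b y > 0" and r_pos: "y \<in> D \<Longrightarrow> r y > 0"
    and open_I: "open I" and I_eq: "I = u ` D"
    and smooth_\<Phi>: "smooth_on \<Phi> I" and \<Phi>_pos: "s \<in> I \<Longrightarrow> \<Phi> s > 0"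
    and F_eq: "y \<in> D \<Longrightarrow> F x y = b y * \<Phi> (u y)"
begin

definition dF :: "real^'n \<Rightarrow> real^'n \<Rightarrow> real" where
  "dF y v = (\<Phi> (u y) - u y * deriv \<Phi> (u y)) * b v + deriv \<Phi> (u y) * ip (iv y) v"

lemma u_in_I: "y \<in> D \<Longrightarrow> u y \<in> I"
  by (simp add: I_eq)

lemma F_pos: "y \<in> D \<Longrightarrow> F x y > 0"
  by (simp add: F_eq b_pos u_in_I \<Phi>_pos)

lemma has_derivative_F: "y \<in> D \<Longrightarrow> (F x has_derivative dF y) (at y)"
  and tensor_F: "y \<in> D \<Longrightarrow> fundamental_tensor F x y $ m $ n =
      dF y (axis m 1) * dF y (axis n 1)
      + F x y * (b y * deriv (deriv \<Phi>) (u y) * du y (axis m 1) * du y (axis n 1)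
          + deriv \<Phi> (u y) / r y * K y (axis m 1) (axis n 1))"
proof -
  assume y: "y \<in> D"
  have d: "(\<Phi> has_real_derivative deriv \<Phi> (u z)) (at (u z))"
      "(deriv \<Phi> has_real_derivative deriv (deriv \<Phi>) (u z)) (at (u z))" if "z \<in> D" for z
    using u_in_I[OF that] smooth_\<Phi> smooth_on_deriv[OF open_I smooth_\<Phi>]
    by (auto intro: smooth_on_real_has_deriv)
  note facts = open_D y b_pos r_pos F_eq d
  show "(F x has_derivative dF y) (at y)"
    unfolding dF_def[abs_def]
    by (rule fundamental_tensor_fs(1)[where D = D]) (use facts in blast)+
  show "fundamental_tensor F x y $ m $ n =
      dF y (axis m 1) * dF y (axis n 1)
      + F x y * (b y * deriv (deriv \<Phi>) (u y) * du y (axis m 1) * du y (axis n 1)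
          + deriv \<Phi> (u y) / r y * K y (axis m 1) (axis n 1))"
    unfolding dF_def[abs_def]
    by (rule fundamental_tensor_fs(2)[where D = D]) (use facts in blast)+
qed

text \<open>In the direction \<open>e\<close> the form K drops out. Used to exclude a vanishing
  scalar in the quadratic.\<close>

lemma tensor_F_e:
  assumes y: "y \<in> D"
  shows "e \<bullet> (fundamental_tensor F x y *v e) =
    (dF y e)\<^sup>2 + F x y * b y * deriv (deriv \<Phi>) (u y) * (du y e)\<^sup>2"
proof -
  let ?\<alpha> = "F x y * b y * deriv (deriv \<Phi>) (u y)" and ?\<gamma> = "F x y * deriv \<Phi> (u y) / r y"
  have 1: "bilinear (\<lambda>v w. dF y v * dF y w)"
    by (simp add: bilinear_def linear_iff dF_def ip.add_right ip.scaleR_right b.add b.scaleR algebra_simps)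
  have 2: "bilinear (\<lambda>v w. dF y v * dF y w + (?\<alpha> * (du y v * du y w) + ?\<gamma> * K y v w))"
    using 1 bilinear_du_K[of ?\<alpha> y ?\<gamma>] unfolding bilinear_def by (auto intro: linear_compose_add)
  have "e \<bullet> (fundamental_tensor F x y *v e) = dF y e * dF y e + (?\<alpha> * (du y e * du y e) + ?\<gamma> * K y e e)"
    by (rule matrix_form_eq[OF 2]) (simp add: tensor_F[OF y] algebra_simps)
  then show ?thesis by (simp add: K_e power2_eq_square)
qed

text \<open>By \<open>ip_t\<close> both sides contain the same dF^2, so they differ by \<alpha> du^2
  + \<gamma> K. Independence forces \<alpha> = \<gamma> = 0, and each of these is a nonzero multiple
  of the defect in one of the two equations.\<close>

lemma conformal_iff:
  assumes "CARD('n) \<ge> 3" and sm: "smooth_on \<sigma> I" "smooth_on \<kappa> I"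
    and unit: "\<And>s. s \<in> I \<Longrightarrow> (\<sigma> s)\<^sup>2 + (\<kappa> s)\<^sup>2 = 1"
    and "H > 0"
    and t: "\<forall>y\<in>D. t y = (F x y powr H) *\<^sub>R (\<sigma> (u y) *\<^sub>R iv y + \<kappa> (u y) *\<^sub>R e)"
    and y: "y \<in> D"
  shows "(\<forall>m n. fundamental_tensor F x y $ m $ n = (1 / H * F x y powr (1 - H))\<^sup>2 *
      (\<Sum>i\<in>UNIV. \<Sum>j\<in>UNIV. a x $ i $ j * jacobian t (at y) $ i $ m * jacobian t (at y) $ j $ n))
    \<longleftrightarrow> H\<^sup>2 * deriv (deriv \<Phi>) (u y) = \<Phi> (u y) * ((deriv \<sigma> (u y))\<^sup>2 + (deriv \<kappa> (u y))\<^sup>2)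
      \<and> H\<^sup>2 * (u y * deriv \<Phi> (u y)) = \<Phi> (u y) * (\<sigma> (u y))\<^sup>2"
proof -
  note uI = u_in_I[OF y] and pos = b_pos[OF y] r_pos[OF y] \<Phi>_pos[OF u_in_I[OF y]]
  note d = smooth_on_real_has_deriv[OF sm(1) uI] smooth_on_real_has_deriv[OF sm(2) uI]
  have perp: "\<sigma> (u y) * deriv \<sigma> (u y) + \<kappa> (u y) * deriv \<kappa> (u y) = 0"
  proof -
    have "((\<lambda>s. (\<sigma> s)\<^sup>2 + (\<kappa> s)\<^sup>2) has_real_derivative
        2 * (\<sigma> (u y) * deriv \<sigma> (u y) + \<kappa> (u y) * deriv \<kappa> (u y))) (at (u y))"
      by (rule derivative_eq_intros d refl | simp)+
    then have "((\<lambda>s. 1) has_real_derivative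
        2 * (\<sigma> (u y) * deriv \<sigma> (u y) + \<kappa> (u y) * deriv \<kappa> (u y))) (at (u y))"
      by (rule has_field_derivative_transform_within_open[OF _ open_I uI]) (simp add: unit)
    from DERIV_unique[OF this DERIV_const] show ?thesis by simp
  qed
  define s2 where "s2 = (deriv \<sigma> (u y))\<^sup>2 + (deriv \<kappa> (u y))\<^sup>2"
  note t' = has_derivative_t[OF open_D y pos(1,2) t has_derivative_F[OF y] F_pos[OF y] d]
  define \<alpha> where "\<alpha> = F x y * b y * deriv (deriv \<Phi>) (u y) - (F x y)\<^sup>2 / H\<^sup>2 * s2"
  define \<gamma> where "\<gamma> = F x y * deriv \<Phi> (u y) / r y - (F x y)\<^sup>2 / H\<^sup>2 * ((\<sigma> (u y))\<^sup>2 / (r y)\<^sup>2)"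
  have "fundamental_tensor F x y $ m $ n = (1 / H * F x y powr (1 - H))\<^sup>2 *
      (\<Sum>i\<in>UNIV. \<Sum>j\<in>UNIV. a x $ i $ j * jacobian t (at y) $ i $ m * jacobian t (at y) $ j $ n)
    \<longleftrightarrow> \<alpha> * (du y (axis m 1) * du y (axis n 1)) + \<gamma> * K y (axis m 1) (axis n 1) = 0" for m n
  proof -
    have "(1 / H * F x y powr (1 - H))\<^sup>2 *
        (\<Sum>i\<in>UNIV. \<Sum>j\<in>UNIV. a x $ i $ j * jacobian t (at y) $ i $ m * jacobian t (at y) $ j $ n)
      = dF y (axis m 1) * dF y (axis n 1) + (F x y)\<^sup>2 / H\<^sup>2 * (s2 * du y (axis m 1) * du y (axis n 1)
        + (\<sigma> (u y))\<^sup>2 / (r y)\<^sup>2 * K y (axis m 1) (axis n 1))"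
      unfolding sum_jacobian[OF t'] s2_def
      by (rule ip_t[OF pos(2) F_pos[OF y] _ unit[OF uI] perp]) (use \<open>H > 0\<close> in simp)
    then show ?thesis
      by (auto simp: tensor_F[OF y] \<alpha>_def \<gamma>_def algebra_simps)
  qed
  then have "(\<forall>m n. fundamental_tensor F x y $ m $ n = (1 / H * F x y powr (1 - H))\<^sup>2 *
      (\<Sum>i\<in>UNIV. \<Sum>j\<in>UNIV. a x $ i $ j * jacobian t (at y) $ i $ m * jacobian t (at y) $ j $ n))
    \<longleftrightarrow> \<alpha> = 0 \<and> \<gamma> = 0"
    using du_K_zero[OF assms(1) pos(1,2), of \<alpha> \<gamma>] by auto
  moreover have "\<alpha> = ((b y)\<^sup>2 * \<Phi> (u y) / H\<^sup>2) * (H\<^sup>2 * deriv (deriv \<Phi>) (u y) - \<Phi> (u y) * s2)"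
    using \<open>H > 0\<close> by (simp add: \<alpha>_def F_eq[OF y] power2_eq_square field_simps)
  moreover have "\<gamma> = ((b y)\<^sup>2 * \<Phi> (u y) / (H\<^sup>2 * (r y)\<^sup>2)) * (H\<^sup>2 * (u y * deriv \<Phi> (u y)) - \<Phi> (u y) * (\<sigma> (u y))\<^sup>2)"
    using \<open>H > 0\<close> pos by (simp add: \<gamma>_def F_eq[OF y] wt_fun_def power2_eq_square field_simps)
  ultimately show ?thesis
    using \<open>H > 0\<close> pos unfolding s2_def by auto
qed

text \<open>A kernel vector of the derivative would be null for the pulled back metric, hence for
  the positive definite fundamental tensor.\<close>

lemma conformal_deriv_inj:
  assumes "(t has_derivative t') (at y)"
    and eq: "\<And>m n. fundamental_tensor F x y $ m $ n = p\<^sup>2 *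
      (\<Sum>i\<in>UNIV. \<Sum>j\<in>UNIV. a x $ i $ j * jacobian t (at y) $ i $ m * jacobian t (at y) $ j $ n)"
    and pd: "\<And>v. v \<noteq> 0 \<Longrightarrow> v \<bullet> (fundamental_tensor F x y *v v) > 0"
  shows "inj t'"
proof -
  interpret t': linear t' using assms(1) by (rule has_derivative_linear)
  have "bilinear (\<lambda>v w. p\<^sup>2 * ip (t' v) (t' w))"
    by (simp add: bilinear_def linear_iff t'.add t'.scaleR ip.add_left ip.add_right ip.scaleR_left ip.scaleR_right algebra_simps)
  then have "v \<bullet> (fundamental_tensor F x y *v v) = p\<^sup>2 * ip (t' v) (t' v)" for v
    by (rule matrix_form_eq) (simp add: eq sum_jacobian[OF assms(1)])
  then have "v = 0" if "t' v = 0" for v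
    using pd[of v] that by (cases "v = 0") (auto simp: ip.zero_left)
  then show ?thesis by (auto simp: t'.linear_axioms linear_injective_0)
qed

end

section \<open>Smooth dependence on the base point\<close>

locale fs_geometry =
  fixes U :: "(real^'n) set" and a :: "real^'n \<Rightarrow> real^'n^'n" and \<beta> :: "real^'n \<Rightarrow> real^'n"
    and W :: "((real^'n) \<times> real) set" and V :: "real^'n \<Rightarrow> real \<Rightarrow> real"
  assumes fs: "fs_space U a \<beta> W V"
begin

abbreviation "D \<equiv> fs_domain U a \<beta> W"
abbreviation "M \<equiv> max_domain U a \<beta>"
abbreviation "F \<equiv> fs_metric a \<beta> V"

definition Dx :: "real^'n \<Rightarrow> (real^'n) set" where "Dx x = {y. (x, y) \<in> D}"
definition Wx :: "real^'n \<Rightarrow> real set" where "Wx x = {w. (x, w) \<in> W}"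
definition Ix :: "real^'n \<Rightarrow> real set" where "Ix x = wt_fun a \<beta> x ` Dx x"
text \<open>The variable w as a function of u at a fixed base point.\<close>

definition om :: "real^'n \<Rightarrow> real \<Rightarrow> real" where "om x s = sqrt (s\<^sup>2 + 1 / (c_norm a \<beta> x)\<^sup>2 - 1)"
text \<open>The function called V with a tilde when F is written in the tilded variable.\<close>

definition \<Phi> :: "real^'n \<Rightarrow> real \<Rightarrow> real" where "\<Phi> x s = V x (om x s)"

lemma open_U: "open U" and smooth_a: "smooth_on a U" and smooth_\<beta>: "smooth_on \<beta> U"
  and open_W: "open W" and smooth_V: "smooth_on (\<lambda>(x, w). V x w) W"
  and smooth_F: "smooth_on (\<lambda>(x, y). F x y) D"
  using fs by (auto simp: fs_space_def riemannian_metric_on_def w_domain_def finsler_metric_on_def)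

lemma F_props:
  assumes "(x, y) \<in> D"
  shows "F x y > 0" "v \<noteq> 0 \<Longrightarrow> v \<bullet> (fundamental_tensor F x y *v v) > 0"
    "k > 0 \<Longrightarrow> F x (k *\<^sub>R y) = k * F x y"
  using fs assms by (auto simp: fs_space_def finsler_metric_on_def)

lemma point: "x \<in> U \<Longrightarrow> fs_point a \<beta> x"
  using fs by (auto simp: fs_space_def riemannian_metric_on_def fs_point_def)

lemma M_D: "p \<in> M \<Longrightarrow> fst p \<in> U" "D \<subseteq> M" "p \<in> D \<Longrightarrow> fst p \<in> U"
  by (auto simp: max_domain_def fs_domain_def)

section \<open>Smoothness of the Riemannian data in the base point\<close>

lemma smooth_entry: "smooth_on (\<lambda>x. a x $ i $ j) U"
  by (intro smooth_on_vec_nth open_U smooth_a)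

lemma smooth_b_up: "smooth_on (b_up a \<beta>) U"
proof (rule smooth_on_cong[OF open_U])
  show "(\<chi> k. det (\<chi> i j. if j = k then \<beta> x $ i else a x $ i $ j) / det (a x)) = b_up a \<beta> x"
    if "x \<in> U" for x
    using fs_point.B_eq[OF point[OF that]] by simp
  have "smooth_on (\<lambda>x. if j = k then \<beta> x $ i else a x $ i $ j) U" for i j k
    using smooth_on_vec_nth[OF open_U smooth_\<beta>] smooth_entry by (cases "j = k") simp_all
  then have "smooth_on (\<lambda>x. det (\<chi> i j. if j = k then \<beta> x $ i else a x $ i $ j)) U" for k
    by (intro smooth_on_det open_U) simp
  then show "smooth_on (\<lambda>x. \<chi> k. det (\<chi> i j. if j = k then \<beta> x $ i else a x $ i $ j) / det (a x)) U"
    using smooth_on_det[OF open_U smooth_entry] fs_point.det_a[OF point]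
    by (intro smooth_on_vec_lambda smooth_on_divide open_U) auto
qed

lemma smooth_c2: "smooth_on (\<lambda>x. (c_norm a \<beta> x)\<^sup>2) U"
  by (rule smooth_on_cong[OF open_U _ smooth_on_inner[OF open_U smooth_\<beta> smooth_b_up]])
    (simp add: fs_point.c_power2[OF point])

lemma c_pos: "x \<in> U \<Longrightarrow> c_norm a \<beta> x > 0"
  using fs_point.c_pos[OF point] .

lemma smooth_c: "smooth_on (c_norm a \<beta>) U"
proof (rule smooth_on_cong[OF open_U])
  show "smooth_on (\<lambda>x. sqrt ((c_norm a \<beta> x)\<^sup>2)) U"
    by (rule smooth_on_sqrt[OF open_U smooth_c2]) (rule zero_less_power[OF c_pos])
  show "sqrt ((c_norm a \<beta> x)\<^sup>2) = c_norm a \<beta> x" if "x \<in> U" for x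
    using c_pos[OF that] by simp
qed

lemma smooth_e: "smooth_on (b_up_unit a \<beta>) U"
proof -
  have "c_norm a \<beta> x \<noteq> 0" if "x \<in> U" for x using c_pos[OF that] by simp
  then show ?thesis
    unfolding b_up_unit_def[abs_def]
    by (intro smooth_on_scaleR smooth_on_divide smooth_on_const open_U smooth_c smooth_b_up)
qed

lemma smooth_base:
  fixes f :: "real^'n \<Rightarrow> 'c::real_normed_vector" and S :: "((real^'n) \<times> 'b::real_normed_vector) set"
  shows "smooth_on f U \<Longrightarrow> open S \<Longrightarrow> (\<And>p. p \<in> S \<Longrightarrow> fst p \<in> U) \<Longrightarrow> smooth_on (\<lambda>p. f (fst p)) S"
  by (rule smooth_on_fst_comp[OF _ open_U])

section \<open>Openness of the domain and smoothness of the variables on it\<close>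

abbreviation "UU \<equiv> U \<times> (UNIV :: (real^'n) set)"

text \<open>The square of \<open>qt_fun\<close> over \<open>U\<close>; smooth on all of
  \<open>UU\<close>, including the points where the root is not, so the positivity domain is seen to
  be open.\<close>

definition rad :: "(real^'n) \<times> (real^'n) \<Rightarrow> real" where
  "rad p = snd p \<bullet> (a (fst p) *v snd p) - (one_form \<beta> (fst p) (snd p))\<^sup>2 / (c_norm a \<beta> (fst p))\<^sup>2"

lemma open_UU: "open UU" by (intro open_Times open_U open_UNIV)

lemma smooth_b: "smooth_on (\<lambda>p. one_form \<beta> (fst p) (snd p)) UU"
  unfolding one_form_def
  by (intro smooth_on_inner open_UU smooth_base[OF smooth_\<beta>] smooth_on_snd) auto

lemma smooth_rad: "smooth_on rad UU"
proof -
  have "smooth_on (\<lambda>p. a (fst p) *v snd p) UU"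
    unfolding matrix_vector_mult_def
    by (intro smooth_on_vec_lambda smooth_on_sum smooth_on_mult open_UU smooth_base[OF smooth_entry]
        smooth_on_vec_nth smooth_on_snd) auto
  moreover have "c_norm a \<beta> (fst p) \<noteq> 0" if "p \<in> UU" for p
    using c_pos[of "fst p"] that by auto
  ultimately show ?thesis
    unfolding rad_def[abs_def]
    by (intro smooth_on_diff smooth_on_inner smooth_on_divide smooth_on_power2 smooth_on_snd open_UU smooth_b
        smooth_base[OF smooth_c]) auto
qed

lemma qt_eq: "fst p \<in> U \<Longrightarrow> qt_fun a \<beta> (fst p) (snd p) = sqrt (rad p)"
  using fs_point.r_eq[OF point] fs_point.ip_def[OF point] by (simp add: rad_def)

lemma M_eq: "M = (UU \<inter> (\<lambda>p. one_form \<beta> (fst p) (snd p)) -` {0<..}) \<inter> (UU \<inter> rad -` {0<..})"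
  using qt_eq by (force simp: max_domain_def)

lemma open_M: "open M"
  unfolding M_eq
  by (intro open_Int continuous_open_preimage smooth_on_imp_continuous_on smooth_b smooth_rad open_UU open_greaterThan)

lemma M_UU: "M \<subseteq> UU" by (auto simp: M_eq)

lemma smooth_b_M: "smooth_on (\<lambda>p. one_form \<beta> (fst p) (snd p)) M"
  by (rule smooth_on_subset[OF smooth_b M_UU])

lemma smooth_qt: "smooth_on (\<lambda>p. qt_fun a \<beta> (fst p) (snd p)) M"
proof (rule smooth_on_cong[OF open_M])
  show "smooth_on (\<lambda>p. sqrt (rad p)) M"
    by (rule smooth_on_sqrt[OF open_M smooth_on_subset[OF smooth_rad M_UU]]) (simp add: M_eq)
  show "sqrt (rad p) = qt_fun a \<beta> (fst p) (snd p)" if "p \<in> M" for p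
    using qt_eq[OF M_D(1)[OF that]] by simp
qed

lemma M_pos: "p \<in> M \<Longrightarrow> one_form \<beta> (fst p) (snd p) > 0" "p \<in> M \<Longrightarrow> qt_fun a \<beta> (fst p) (snd p) > 0"
  by (auto simp: max_domain_def)

lemma inverse_c: "x \<in> U \<Longrightarrow> 1 / (c_norm a \<beta> x)\<^sup>2 \<ge> 1"
  using fs_point.inverse_c[OF point] .

lemma smooth_inverse_c2: "smooth_on (\<lambda>x. 1 / (c_norm a \<beta> x)\<^sup>2) U"
  by (rule smooth_on_divide[OF open_U smooth_on_const[OF open_U] smooth_c2]) (use c_pos in force)

text \<open>Through u rather than q: the radicand u^2 + 1/c^2 - 1 is visibly positive, as u > 0 and
  c < 1.\<close>

lemma smooth_w: "smooth_on (\<lambda>p. w_fun a \<beta> (fst p) (snd p)) M"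
proof (rule smooth_on_cong[OF open_M])
  let ?u = "\<lambda>p. qt_fun a \<beta> (fst p) (snd p) / one_form \<beta> (fst p) (snd p)"
  have "(?u p)\<^sup>2 + 1 / (c_norm a \<beta> (fst p))\<^sup>2 - 1 > 0" if "p \<in> M" for p
  proof -
    have "(?u p)\<^sup>2 > 0" using M_pos[OF that] by simp
    then show ?thesis using inverse_c[OF M_D(1)[OF that]] by linarith
  qed
  moreover have "smooth_on ?u M"
    by (rule smooth_on_divide[OF open_M smooth_qt smooth_b_M]) (use M_pos in force)
  ultimately show "smooth_on (\<lambda>p. sqrt ((?u p)\<^sup>2 + 1 / (c_norm a \<beta> (fst p))\<^sup>2 - 1)) M"
    by (intro smooth_on_sqrt smooth_on_diff smooth_on_add smooth_on_power2 smooth_on_const open_M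
        smooth_base[OF smooth_inverse_c2] M_D(1))
  show "sqrt ((?u p)\<^sup>2 + 1 / (c_norm a \<beta> (fst p))\<^sup>2 - 1) = w_fun a \<beta> (fst p) (snd p)" if "p \<in> M" for p
    using fs_point.wv_eq[OF point[OF M_D(1)[OF that]] M_pos(1)[OF that]] by (simp add: wt_fun_def)
qed

lemma smooth_i_vec: "smooth_on (\<lambda>p. i_vec a \<beta> (fst p) (snd p)) M"
proof -
  have "qt_fun a \<beta> (fst p) (snd p) \<noteq> 0" "c_norm a \<beta> (fst p) \<noteq> 0" if "p \<in> M" for p
    using M_pos[OF that] c_pos[OF M_D(1)[OF that]] by auto
  then show ?thesis
    unfolding i_vec_def
    by (intro smooth_on_scaleR smooth_on_diff smooth_on_divide smooth_on_power2 smooth_on_const smooth_on_snd open_M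
        smooth_qt smooth_b_M smooth_base[OF smooth_c] smooth_base[OF smooth_b_up] M_D(1)) auto
qed

lemma smooth_x_w: "smooth_on (\<lambda>p. (fst p, w_fun a \<beta> (fst p) (snd p))) M"
  by (intro smooth_on_Pair open_M smooth_w smooth_on_bounded_linear[OF bounded_linear_fst])

lemma open_D: "open D"
proof -
  have "D = M \<inter> (\<lambda>p. (fst p, w_fun a \<beta> (fst p) (snd p))) -` W"
    by (auto simp: fs_domain_def)
  then show ?thesis
    using continuous_open_preimage[OF smooth_on_imp_continuous_on[OF smooth_x_w] open_M open_W] by simp
qed

lemma smooth_on_w_comp:
  assumes "smooth_on (\<lambda>(x, w). f x w) W"
  shows "smooth_on (\<lambda>p. f (fst p) (w_fun a \<beta> (fst p) (snd p))) D"
proof -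
  have "(\<lambda>p. (fst p, w_fun a \<beta> (fst p) (snd p))) ` D \<subseteq> W"
    by (auto simp: fs_domain_def)
  from smooth_on_compose[OF assms open_D open_W this smooth_on_subset[OF smooth_x_w M_D(2)]]
  show ?thesis by simp
qed

section \<open>Fibers over a base point and the change between w and u\<close>

lemma open_Wx: "open (Wx x)" and open_Dx: "open (Dx x)"
  using open_slice[OF open_W] open_slice[OF open_D] by (simp_all add: Wx_def Dx_def)

lemma Dx_D: "y \<in> Dx x \<longleftrightarrow> (x, y) \<in> D" by (simp add: Dx_def)

lemma Dx_props:
  assumes "y \<in> Dx x"
  shows "x \<in> U" "one_form \<beta> x y > 0" "qt_fun a \<beta> x y > 0" "w_fun a \<beta> x y \<in> Wx x"
    "om x (wt_fun a \<beta> x y) = w_fun a \<beta> x y" "wt_fun a \<beta> x y > 0"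
    "wt_fun a \<beta> x y = sqrt ((w_fun a \<beta> x y)\<^sup>2 + 1 - 1 / (c_norm a \<beta> x)\<^sup>2)" "w_fun a \<beta> x y > 0"
proof -
  show *: "x \<in> U" "one_form \<beta> x y > 0" "qt_fun a \<beta> x y > 0" "w_fun a \<beta> x y \<in> Wx x"
    using assms by (auto simp: Dx_def Wx_def fs_domain_def max_domain_def)
  show "om x (wt_fun a \<beta> x y) = w_fun a \<beta> x y" "wt_fun a \<beta> x y > 0"
    "wt_fun a \<beta> x y = sqrt ((w_fun a \<beta> x y)\<^sup>2 + 1 - 1 / (c_norm a \<beta> x)\<^sup>2)" "w_fun a \<beta> x y > 0"
    using fs_point.wv_eq[OF point[OF *(1)] *(2)] fs_point.u_pos[OF point[OF *(1)] *(2,3)]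
      fs_point.u_eq[OF point[OF *(1)] *(2,3)] fs_point.wv_pos[OF point[OF *(1)] *(2,3)]
    by (simp_all add: om_def)
qed

text \<open>\<open>w_domain\<close> admits attained values only; facts about values of w thus reduce
  to facts about vectors.\<close>

lemma Wx_obtain:
  assumes "w \<in> Wx x" obtains y where "y \<in> Dx x" "w_fun a \<beta> x y = w"
proof -
  have "(x, w) \<in> (\<lambda>(x, y). (x, w_fun a \<beta> x y)) ` M"
    using fs assms by (auto simp: fs_space_def w_domain_def Wx_def)
  then obtain y where "(x, y) \<in> M" "w_fun a \<beta> x y = w" by auto
  then show ?thesis using that assms by (auto simp: Dx_def fs_domain_def Wx_def)
qed

lemma Ix_props:
  assumes "s \<in> Ix x"
  shows "x \<in> U" "s > 0" "om x s \<in> Wx x" "om x s > 0" "s\<^sup>2 + 1 / (c_norm a \<beta> x)\<^sup>2 - 1 > 0"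
    "sqrt ((om x s)\<^sup>2 + 1 - 1 / (c_norm a \<beta> x)\<^sup>2) = s"
proof -
  obtain y where y: "y \<in> Dx x" "s = wt_fun a \<beta> x y" using assms by (auto simp: Ix_def)
  show *: "x \<in> U" "s > 0" "om x s \<in> Wx x" "om x s > 0" "sqrt ((om x s)\<^sup>2 + 1 - 1 / (c_norm a \<beta> x)\<^sup>2) = s"
    using Dx_props[OF y(1)] by (simp_all add: y(2))
  show "s\<^sup>2 + 1 / (c_norm a \<beta> x)\<^sup>2 - 1 > 0"
    using inverse_c[OF *(1)] zero_less_power[OF *(2), of 2] by linarith
qed

lemma Ix_image: "Ix x = (\<lambda>w. sqrt (w\<^sup>2 + 1 - 1 / (c_norm a \<beta> x)\<^sup>2)) ` Wx x"
proof
  show "Ix x \<subseteq> (\<lambda>w. sqrt (w\<^sup>2 + 1 - 1 / (c_norm a \<beta> x)\<^sup>2)) ` Wx x"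
    using Ix_props(3,6) by (metis (no_types, lifting) imageI subsetI)
  show "(\<lambda>w. sqrt (w\<^sup>2 + 1 - 1 / (c_norm a \<beta> x)\<^sup>2)) ` Wx x \<subseteq> Ix x"
  proof clarify
    fix w assume "w \<in> Wx x"
    then obtain y where y: "y \<in> Dx x" "w_fun a \<beta> x y = w" by (rule Wx_obtain)
    then show "sqrt (w\<^sup>2 + 1 - 1 / (c_norm a \<beta> x)\<^sup>2) \<in> Ix x"
      unfolding Ix_def y(2)[symmetric] Dx_props(7)[OF y(1), symmetric] by (intro imageI)
  qed
qed

lemma om_smooth: "x \<in> U \<Longrightarrow> smooth_on (om x) {0<..}"
proof -
  assume x: "x \<in> U"
  have "s\<^sup>2 + 1 / (c_norm a \<beta> x)\<^sup>2 - 1 > 0" if "s \<in> {0<..}" for s :: real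
  proof -
    have "s\<^sup>2 > 0" using that by simp
    then show ?thesis using inverse_c[OF x] by linarith
  qed
  then show ?thesis
    unfolding om_def[abs_def]
    by (intro smooth_on_sqrt smooth_on_diff smooth_on_add smooth_on_power2 smooth_on_ident smooth_on_const open_greaterThan)
qed

lemma open_Ix: assumes "x \<in> U" shows "open (Ix x)"
proof -
  \<comment> \<open>The change of variable from u to w presents \<open>Ix x\<close> as a preimage
    under a map that is continuous on the open half-line.\<close>
  have "Ix x = {0<..} \<inter> om x -` Wx x"
  proof (intro equalityI subsetI)
    fix s assume s: "s \<in> {0<..} \<inter> om x -` Wx x"
    then have "sqrt ((om x s)\<^sup>2 + 1 - 1 / (c_norm a \<beta> x)\<^sup>2) \<in> Ix x"
      unfolding Ix_image by blast
    moreover have "s\<^sup>2 + 1 / (c_norm a \<beta> x)\<^sup>2 - 1 \<ge> 0"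
      using inverse_c[OF assms] zero_le_power2[of s] by linarith
    ultimately show "s \<in> Ix x" using s by (simp add: om_def)
  qed (use Ix_props in auto)
  then show ?thesis
    using continuous_open_preimage[OF smooth_on_imp_continuous_on[OF om_smooth[OF assms]] open_greaterThan open_Wx]
    by simp
qed

text \<open>The interval condition on \<open>W\<close>, carried over by the continuous change from w
  to u.\<close>

lemma connected_Ix: assumes "x \<in> U" shows "connected (Ix x)" "Ix x \<noteq> {}"
proof -
  have "connected (Wx x)" "Wx x \<noteq> {}"
    using fs assms by (auto simp: fs_space_def w_domain_def Wx_def)
  then show "connected (Ix x)" "Ix x \<noteq> {}"
    unfolding Ix_image by (auto intro!: connected_continuous_image continuous_intros)
qed

lemma smooth_om_comp:
  fixes f :: "real \<Rightarrow> real"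
  assumes "x \<in> U" "smooth_on f (Wx x)" shows "smooth_on (\<lambda>s. f (om x s)) (Ix x)"
  by (rule smooth_on_compose[OF assms(2) open_Ix[OF assms(1)] open_Wx _
      smooth_on_subset[OF om_smooth[OF assms(1)]]]) (auto simp: Ix_props)

lemma smooth_slice_W: "smooth_on (\<lambda>(x, w). f x w) W \<Longrightarrow> smooth_on (f x :: real \<Rightarrow> real) (Wx x)"
  unfolding Wx_def by (rule smooth_on_slice[OF open_W])

lemma fiber: assumes x: "x \<in> U" shows "fs_fiber a \<beta> x F (Dx x) (Ix x) (\<Phi> x)"
proof -
  interpret fs_point a \<beta> x by (rule point[OF x])
  have F: "F x y = b y * \<Phi> x (u y)" if "y \<in> Dx x" for y
    using Dx_props(5)[OF that] by (simp add: fs_metric_def \<Phi>_def)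
  have "\<Phi> x s > 0" if s: "s \<in> Ix x" for s
  proof -
    obtain y where y: "y \<in> Dx x" "s = u y" using s by (auto simp: Ix_def)
    then have "b y * \<Phi> x s > 0" using F_props(1)[of x y] F[OF y(1)] by (simp add: Dx_D)
    then show ?thesis using Dx_props(2)[OF y(1)] by (simp add: zero_less_mult_iff)
  qed
  moreover have "smooth_on (\<Phi> x) (Ix x)"
    using smooth_om_comp[OF x smooth_slice_W[OF smooth_V]] by (simp add: \<Phi>_def[abs_def])
  ultimately show ?thesis
    using F open_Dx open_Ix[OF x] Dx_props(2,3) by unfold_locales (auto simp: Ix_def[symmetric])
qed

lemma deriv_om:
  assumes "s \<in> Ix x" shows "(om x has_real_derivative s / om x s) (at s)"
proof -
  have "((\<lambda>s. s\<^sup>2 + k - 1) has_real_derivative 2 * s) (at s)" for k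
    by (auto intro!: derivative_eq_intros)
  then have "((\<lambda>s. s\<^sup>2 + 1 / (c_norm a \<beta> x)\<^sup>2 - 1) has_real_derivative 2 * s) (at s)" .
  from DERIV_chain2[where f = sqrt and g = "\<lambda>s. s\<^sup>2 + 1 / (c_norm a \<beta> x)\<^sup>2 - 1" and x = s, OF DERIV_real_sqrt[OF Ix_props(5)[OF assms]] this]
  have "(om x has_real_derivative inverse (om x s) / 2 * (2 * s)) (at s)"
    unfolding om_def[abs_def] .
  moreover have "inverse (om x s) / 2 * (2 * s) = s / om x s"
    by (simp add: inverse_eq_divide)
  ultimately show ?thesis by (simp only:)
qed

text \<open>Since dw/du = u/w, the factor u cancels, and the quotient \<tau> has the same shape in
  both variables.\<close>

lemma tau_eq:
  assumes s: "s \<in> Ix x" shows "tau V x (om x s) = s * \<Phi> x s / deriv (\<Phi> x) s"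
proof -
  have "(V x has_real_derivative deriv (V x) (om x s)) (at (om x s))"
    by (rule smooth_on_real_has_deriv[OF smooth_slice_W[OF smooth_V] Ix_props(3)[OF s]])
  from DERIV_imp_deriv[OF DERIV_chain2[where f = "V x" and g = "om x" and x = s, OF this deriv_om[OF s]]]
  have "deriv (\<Phi> x) s = deriv (V x) (om x s) * (s / om x s)" by (simp add: \<Phi>_def[abs_def])
  then show ?thesis
    using Ix_props(2,4)[OF s] by (simp add: tau_def \<Phi>_def)
qed

end

section \<open>Conformal automorphisms\<close>

text \<open>With 1/S and X/S as sine and cosine of the polar angle \<theta>, this inverts the
  Moebius change cos \<theta> = (C1 + C cos \<rho>) / (C + C1 cos \<rho>). The inverse has sin
  \<rho> = H / M and cos \<rho> = (C X - C1 S) / M, whose quotient is the argument of arctan; pi/2 -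
  arctan is the branch of the arccotangent with values in (0, pi).\<close>

lemma conformal_angle:
  fixes C C1 X :: real
  assumes "C > \<bar>C1\<bar>"
  defines "H \<equiv> sqrt (C\<^sup>2 - C1\<^sup>2)" and "S \<equiv> sqrt (1 + X\<^sup>2)"
  defines "\<rho> \<equiv> pi / 2 - arctan ((C * X - C1 * S) / H)"
  shows "H * sin \<rho> / (C + C1 * cos \<rho>) = 1 / S"
    and "(C1 + C * cos \<rho>) / (C + C1 * cos \<rho>) = X / S"
proof -
  define q where "q = (C * X - C1 * S) / H"
  define M where "M = C * S - C1 * X"
  have "C1\<^sup>2 < C\<^sup>2" using assms(1) by (metis abs_ge_zero power2_abs power_strict_mono zero_less_numeral)
  then have H: "H > 0" "H\<^sup>2 = C\<^sup>2 - C1\<^sup>2" by (simp_all add: H_def)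
  have S: "S > 0" "S\<^sup>2 = 1 + X\<^sup>2" "\<bar>X\<bar> < S"
    unfolding S_def by (simp_all add: add_pos_nonneg real_less_rsqrt)
  have "C1 * X \<le> \<bar>C1\<bar> * \<bar>X\<bar>" by (metis abs_ge_self abs_mult)
  also have "\<dots> < C * S"
    using assms(1) S by (intro mult_strict_mono') auto
  finally have M: "M > 0" by (simp add: M_def)
  \<comment> \<open>M^2 - (C X - C1 S)^2 factors as (C^2 - C1^2) (S^2 - X^2), and S^2 - X^2 =
    1.\<close>
  have "H\<^sup>2 * (1 + q\<^sup>2) = M\<^sup>2"
  proof -
    have "H * q = C * X - C1 * S" using H(1) by (simp add: q_def)
    then have "H\<^sup>2 * (1 + q\<^sup>2) = H\<^sup>2 + (C * X - C1 * S)\<^sup>2"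
      by (metis distrib_left mult.right_neutral power_mult_distrib)
    also have "\<dots> = M\<^sup>2" unfolding M_def using H(2) S(2) by algebra
    finally show ?thesis .
  qed
  then have "sqrt (1 + q\<^sup>2) = M / H"
    using H(1) M by (intro real_sqrt_unique) (simp_all add: power_divide field_simps)
  then have sc: "sin \<rho> = H / M" "cos \<rho> = (C * X - C1 * S) / M"
    unfolding \<rho>_def q_def[symmetric] sin_diff cos_diff using H(1)
    by (simp_all add: cos_arctan sin_arctan) (simp add: q_def)
  have "C * M + C1 * (C * X - C1 * S) = H\<^sup>2 * S" "C1 * M + C * (C * X - C1 * S) = H\<^sup>2 * X"
    unfolding H(2) M_def by algebra+
  then have "C + C1 * cos \<rho> = H\<^sup>2 * S / M" "C1 + C * cos \<rho> = H\<^sup>2 * X / M"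
    unfolding sc using M by (simp_all add: field_simps)
  then show "H * sin \<rho> / (C + C1 * cos \<rho>) = 1 / S"
    "(C1 + C * cos \<rho>) / (C + C1 * cos \<rho>) = X / S"
    unfolding sc using H(1) S(1) M by (simp_all add: power2_eq_square)
qed

text \<open>The squares of C + C1 cos \<rho> and C1 + C cos \<rho> differ by (C^2 - C1^2) times the
  squared sine, so the Moebius change maps the unit circle into itself.\<close>

lemma conformal_angle_unit:
  fixes C C1 \<rho> :: real
  assumes "C > \<bar>C1\<bar>"
  defines "H \<equiv> sqrt (C\<^sup>2 - C1\<^sup>2)"
  shows "C + C1 * cos \<rho> > 0"
    and "(H * sin \<rho> / (C + C1 * cos \<rho>))\<^sup>2 + ((C1 + C * cos \<rho>) / (C + C1 * cos \<rho>))\<^sup>2 = 1"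
proof -
  have "\<bar>C1 * cos \<rho>\<bar> \<le> \<bar>C1\<bar>" by (simp add: abs_mult mult_left_le)
  then show pos: "C + C1 * cos \<rho> > 0" using assms(1) by linarith
  have "C1\<^sup>2 < C\<^sup>2" using assms(1) by (metis abs_ge_zero power2_abs power_strict_mono zero_less_numeral)
  then have H: "H\<^sup>2 = C\<^sup>2 - C1\<^sup>2" by (simp add: H_def)
  have "(H * sin \<rho>)\<^sup>2 + (C1 + C * cos \<rho>)\<^sup>2 = (C + C1 * cos \<rho>)\<^sup>2"
    using H sin_cos_squared_add[of \<rho>] by algebra
  then show "(H * sin \<rho> / (C + C1 * cos \<rho>))\<^sup>2 + ((C1 + C * cos \<rho>) / (C + C1 * cos \<rho>))\<^sup>2 = 1"
    using pos by (simp add: power_divide flip: add_divide_distrib)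
qed

text \<open>Since H = k (C + C1) and k^2 = (C - C1) / (C + C1), the coefficient of the unit vector
  is (C1 + C cos r) / H, and the transformation takes its Moebius form.\<close>

lemma t_map_eq:
  assumes "C x > \<bar>C1 x\<bar>"
    and r: "r = \<rho> x (w_fun a \<beta> x y)"
  shows "t_map a \<beta> V C C1 \<rho> x y = (fs_metric a \<beta> V x y powr H_deg C C1 x) *\<^sub>R
    ((H_deg C C1 x * sin r / (C x + C1 x * cos r)) *\<^sub>R i_vec a \<beta> x y
      + ((C1 x + C x * cos r) / (C x + C1 x * cos r)) *\<^sub>R b_up_unit a \<beta> x)"
proof -
  define s d k H where defs: "s = C x + C1 x" "d = C x - C1 x" "k = k_breve C C1 x" "H = H_deg C C1 x"
  have sd: "s > 0" "d > 0" using assms(1) by (auto simp: defs)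
  have H: "H = sqrt s * sqrt d"
    by (simp add: H_deg_def defs power2_eq_square algebra_simps flip: real_sqrt_mult)
  have k: "k = sqrt d / sqrt s"
    by (simp add: k_breve_def defs real_sqrt_divide)
  have Hk: "H = k * s" unfolding H k using sd by (simp add: field_simps)
  have k2: "k\<^sup>2 = d / s" unfolding k using sd by (simp add: power_divide)
  have pos: "H > 0" "k > 0" unfolding H k using sd by simp_all
  have "1 / (2 * k) * (1 - k\<^sup>2 + (1 + k\<^sup>2) * cos r) = ((s - d) + (s + d) * cos r) / (2 * (k * s))"
    unfolding k2 using sd pos by (simp add: field_simps)
  also have "\<dots> = (C1 x + C x * cos r) / H"
    unfolding Hk[symmetric] using pos by (simp add: defs field_simps)
  finally have 1: "1 / (2 * k) * (1 - k\<^sup>2 + (1 + k\<^sup>2) * cos r) = (C1 x + C x * cos r) / H" .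
  show ?thesis
    unfolding t_map_def Let_def r[symmetric] defs(3,4)[symmetric] sqrt_mu_eq[where C = C and ?C1.0 = C1 and x = x, OF assms(1)] 1
    using pos by (simp add: scaleR_add_right mult_ac)
qed

section \<open>FS-spaces with the scalars \<open>C\<close> and \<open>C1\<close>: necessity of the
  quadratic\<close>

locale fs_conformal = fs_geometry U a \<beta> W V
  for U :: "(real^'n) set" and a \<beta> W V +
  fixes C C1 :: "real^'n \<Rightarrow> real"
  assumes card: "CARD('n) \<ge> 3" and smooth_C: "smooth_on C U" and smooth_C1: "smooth_on C1 U"
    and C_gt: "x \<in> U \<Longrightarrow> C x > \<bar>C1 x\<bar>"
begin

abbreviation "H \<equiv> H_deg C C1"

lemma C_sq: "x \<in> U \<Longrightarrow> (C x)\<^sup>2 - (C1 x)\<^sup>2 > 0"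
  using power_strict_mono[OF C_gt, of x 2] by simp

lemma H_pos: "x \<in> U \<Longrightarrow> H x > 0"
  using C_sq by (simp add: H_deg_def)

lemma smooth_H: "smooth_on H U"
  unfolding H_deg_def[abs_def]
  by (intro smooth_on_sqrt smooth_on_diff smooth_on_power2 open_U smooth_C smooth_C1 C_sq)

lemma denominator_pos: "x \<in> U \<Longrightarrow> C x + C1 x * cos r > 0"
  using conformal_angle_unit(1)[OF C_gt] .

text \<open>\<open>\<sigma>\<close> and \<open>\<kappa>\<close> are the sine and cosine of the polar
  angle of the transformed vector, the Moebius image of \<rho>, as functions of u.\<close>

definition \<sigma> :: "(real^'n \<Rightarrow> real \<Rightarrow> real) \<Rightarrow> real^'n \<Rightarrow> real \<Rightarrow> real" where
  "\<sigma> \<rho> x s = H x * sin (\<rho> x (om x s)) / (C x + C1 x * cos (\<rho> x (om x s)))"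

definition \<kappa> :: "(real^'n \<Rightarrow> real \<Rightarrow> real) \<Rightarrow> real^'n \<Rightarrow> real \<Rightarrow> real" where
  "\<kappa> \<rho> x s = (C1 x + C x * cos (\<rho> x (om x s))) / (C x + C1 x * cos (\<rho> x (om x s)))"

lemma unit: "x \<in> U \<Longrightarrow> (\<sigma> \<rho> x s)\<^sup>2 + (\<kappa> \<rho> x s)\<^sup>2 = 1"
  unfolding \<sigma>_def \<kappa>_def H_deg_def by (rule conformal_angle_unit(2)[OF C_gt])

lemma smooth_\<sigma>_\<kappa>:
  assumes x: "x \<in> U" and \<rho>: "smooth_on (\<lambda>(x, w). \<rho> x w) W"
  shows "smooth_on (\<sigma> \<rho> x) (Ix x)" "smooth_on (\<kappa> \<rho> x) (Ix x)"
proof -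
  note o = open_Ix[OF x]
  have nz: "C x + C1 x * cos r \<noteq> 0" for r
    using denominator_pos[OF x, of r] by simp
  have "smooth_on (\<lambda>s. \<rho> x (om x s)) (Ix x)"
    by (rule smooth_om_comp[OF x smooth_slice_W[OF \<rho>]])
  note sc = smooth_on_sin[OF o this] smooth_on_cos[OF o this]
  show "smooth_on (\<sigma> \<rho> x) (Ix x)" "smooth_on (\<kappa> \<rho> x) (Ix x)"
    unfolding \<sigma>_def[abs_def] \<kappa>_def[abs_def]
    by (intro smooth_on_divide smooth_on_mult smooth_on_add smooth_on_const o sc nz)+
qed

lemma t_fiber:
  assumes "y \<in> Dx x"
  shows "t_map a \<beta> V C C1 \<rho> x y = (F x y powr H x) *\<^sub>R
    (\<sigma> \<rho> x (wt_fun a \<beta> x y) *\<^sub>R i_vec a \<beta> x y + \<kappa> \<rho> x (wt_fun a \<beta> x y) *\<^sub>R b_up_unit a \<beta> x)"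
  unfolding \<sigma>_def \<kappa>_def Dx_props(5)[OF assms]
  by (rule t_map_eq[where C = C and ?C1.0 = C1 and x = x and \<rho> = \<rho>, OF C_gt[OF Dx_props(1)[OF assms]] refl])

lemma tensor_iff:
  assumes y: "y \<in> Dx x" and \<rho>: "smooth_on (\<lambda>(x, w). \<rho> x w) W"
  defines "J \<equiv> jacobian (t_map a \<beta> V C C1 \<rho> x) (at y)" and "s \<equiv> wt_fun a \<beta> x y"
  shows "(\<forall>m n. fundamental_tensor F x y $ m $ n = (1 / H x * F x y powr (1 - H x))\<^sup>2 *
      (\<Sum>i\<in>UNIV. \<Sum>j\<in>UNIV. a x $ i $ j * J $ i $ m * J $ j $ n))
    \<longleftrightarrow> (H x)\<^sup>2 * deriv (deriv (\<Phi> x)) s = \<Phi> x s * ((deriv (\<sigma> \<rho> x) s)\<^sup>2 + (deriv (\<kappa> \<rho> x) s)\<^sup>2)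
      \<and> (H x)\<^sup>2 * (s * deriv (\<Phi> x) s) = \<Phi> x s * (\<sigma> \<rho> x s)\<^sup>2"
proof -
  note x = Dx_props(1)[OF y]
  have "\<forall>y\<in>Dx x. t_map a \<beta> V C C1 \<rho> x y = (F x y powr H x) *\<^sub>R
    (\<sigma> \<rho> x (wt_fun a \<beta> x y) *\<^sub>R i_vec a \<beta> x y + \<kappa> \<rho> x (wt_fun a \<beta> x y) *\<^sub>R b_up_unit a \<beta> x)"
    using t_fiber by blast
  from fs_fiber.conformal_iff[OF fiber[OF x] card smooth_\<sigma>_\<kappa>[OF x \<rho>] unit[OF x] H_pos[OF x] this y]
  show ?thesis unfolding J_def s_def .
qed

lemma tau_of_conformal_automorphism:
  assumes \<rho>: "smooth_on (\<lambda>(x, w). \<rho> x w) W" "\<forall>(x, w)\<in>W. 0 < \<rho> x w \<and> \<rho> x w < pi"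
    and conf: "conformal_automorphism D a F H (t_map a \<beta> V C C1 \<rho>)"
    and x: "x \<in> U"
  shows "H x \<le> 1"
    and "\<exists>Cb. \<forall>s\<in>Ix x. tau V x (om x s) = Cb\<^sup>2 + 2 * Cb * sqrt (1 - (H x)\<^sup>2) * s + s\<^sup>2"
proof -
  interpret fs_fiber a \<beta> x F "Dx x" "Ix x" "\<Phi> x" by (rule fiber[OF x])
  have AB: "(H x)\<^sup>2 * deriv (deriv (\<Phi> x)) s = \<Phi> x s * ((deriv (\<sigma> \<rho> x) s)\<^sup>2 + (deriv (\<kappa> \<rho> x) s)\<^sup>2)
      \<and> (H x)\<^sup>2 * (s * deriv (\<Phi> x) s) = \<Phi> x s * (\<sigma> \<rho> x s)\<^sup>2" if s: "s \<in> Ix x" for s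
  proof -
    \<comment> \<open>The two equations depend on y through u only, so one vector over each value
      yields them on the whole interval.\<close>
    obtain y where y: "y \<in> Dx x" "s = u y" using s by (auto simp: I_eq)
    show ?thesis
      unfolding y(2)
      by (rule iffD1[OF tensor_iff[OF y(1) \<rho>(1)]])
        (use conf y(1) in \<open>auto simp: conformal_automorphism_def Let_def Dx_D\<close>)
  qed
  have "\<sigma> \<rho> x s > 0" if s: "s \<in> Ix x" for s
  proof -
    \<comment> \<open>The range (0, pi) makes the sine positive, and with it \<sigma>, by which the
      cotangent is divided.\<close>
    have "0 < \<rho> x (om x s)" "\<rho> x (om x s) < pi"
      using \<rho>(2) Ix_props(3)[OF s] by (auto simp: Wx_def)
    then show ?thesis
      unfolding \<sigma>_def using H_pos[OF x] denominator_pos[OF x] by (simp add: sin_gt_zero)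
  qed
  note 1 = tau_of_conformal[OF open_Ix[OF x] connected_Ix[OF x] Ix_props(2) smooth_\<Phi>
      smooth_\<sigma>_\<kappa>[OF x \<rho>(1)] \<Phi>_pos this unit[OF x] H_pos[OF x]] AB
  show "H x \<le> 1"
    by (rule 1(1)) (use AB in auto)
  have "\<exists>Cb. \<forall>s\<in>Ix x. s * \<Phi> x s / deriv (\<Phi> x) s = Cb\<^sup>2 + 2 * Cb * sqrt (1 - (H x)\<^sup>2) * s + s\<^sup>2"
    by (rule 1(2)) (use AB in auto)
  then show "\<exists>Cb. \<forall>s\<in>Ix x. tau V x (om x s) = Cb\<^sup>2 + 2 * Cb * sqrt (1 - (H x)\<^sup>2) * s + s\<^sup>2"
    using tau_eq[of _ x] by simp
qed

section \<open>Construction of the angle from \<tau>\<close>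

definition ups :: "real^'n \<Rightarrow> real \<Rightarrow> real" where
  "ups x w = sqrt (w\<^sup>2 + 1 - 1 / (c_norm a \<beta> x)\<^sup>2)"

text \<open>
  For \<open>\<tau> = C\<^sup>2 + 2 C R u + u\<^sup>2\<close> one has \<open>\<tau> - u \<tau>' + u\<^sup>2 = C\<^sup>2\<close>; this is \<open>Q\<close>, and \<open>X\<close> is the cotangent
  \<open>(\<tau> - u \<tau>'/2) / (H u \<bar>C\<bar>)\<close>, both rewritten with derivatives in \<open>w\<close> by means of \<open>u du = w dw\<close>.
\<close>

definition Q :: "real^'n \<Rightarrow> real \<Rightarrow> real" where
  "Q x w = tau V x w - (ups x w)\<^sup>2 * deriv (tau V x) w / w + (ups x w)\<^sup>2"

definition X :: "real^'n \<Rightarrow> real \<Rightarrow> real" where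
  "X x w = (tau V x w - (ups x w)\<^sup>2 * deriv (tau V x) w / (2 * w)) / (H x * ups x w * sqrt (Q x w))"

text \<open>The formula of \<open>conformal_angle\<close> with the cotangent \<open>X\<close>; it is
  built from \<tau> and the given scalars, without choosing the scalar of the quadratic.\<close>

definition angle :: "real^'n \<Rightarrow> real \<Rightarrow> real" where
  "angle x w = pi / 2 - arctan ((C x * X x w - C1 x * sqrt (1 + (X x w)\<^sup>2)) / H x)"

lemma angle_bounds: "0 < angle x w" "angle x w < pi"
  using arctan_ubound arctan_lbound unfolding angle_def by (smt (verit) field_sum_of_halves)+

text \<open>Here \<open>ups x\<close> serves as the inverse of \<open>om x\<close>, expressing u
  through w.\<close>

lemma W_props:
  assumes "w \<in> Wx x"
  shows "x \<in> U" "w > 0" "ups x w > 0" "ups x w \<in> Ix x" "om x (ups x w) = w" "(ups x w)\<^sup>2 = w\<^sup>2 + 1 - 1 / (c_norm a \<beta> x)\<^sup>2"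
proof -
  obtain y where y: "y \<in> Dx x" "w_fun a \<beta> x y = w" using assms by (rule Wx_obtain)
  have u: "wt_fun a \<beta> x y = ups x w" using Dx_props(7)[OF y(1)] by (simp add: ups_def y(2))
  show "ups x w \<in> Ix x" unfolding u[symmetric] Ix_def using y(1) by (rule imageI)
  show *: "x \<in> U" "w > 0" "ups x w > 0" "om x (ups x w) = w"
    using Dx_props(1,5,6,8)[OF y(1)] unfolding y(2) u by simp_all
  show "(ups x w)\<^sup>2 = w\<^sup>2 + 1 - 1 / (c_norm a \<beta> x)\<^sup>2"
    using *(3) by (simp add: ups_def)
qed

lemma W_Wx: "p \<in> W \<longleftrightarrow> snd p \<in> Wx (fst p)"
  by (simp add: Wx_def)

section \<open>Sufficiency, from a quadratic whose scalar \<open>Cb\<close> is given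
  pointwise\<close>

context
  fixes Cb :: "real^'n \<Rightarrow> real"
  assumes H_le: "x \<in> U \<Longrightarrow> H x \<le> 1"
    and tau: "s \<in> Ix x \<Longrightarrow> tau V x (om x s) = (Cb x)\<^sup>2 + 2 * Cb x * sqrt (1 - (H x)\<^sup>2) * s + s\<^sup>2"
begin

definition T :: "real^'n \<Rightarrow> real \<Rightarrow> real" where
  "T x s = (Cb x)\<^sup>2 + 2 * Cb x * sqrt (1 - (H x)\<^sup>2) * s + s\<^sup>2"

text \<open>Completing the square presents T as (Cb + R s)^2 + (H s)^2 with R^2 = 1 - H^2; this uses
  H \<le> 1.\<close>

lemma T_pos: assumes "x \<in> U" "s > 0" shows "T x s > 0"
proof -
  have "(sqrt (1 - (H x)\<^sup>2))\<^sup>2 = 1 - (H x)\<^sup>2"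
    using H_le[OF assms(1)] H_pos[OF assms(1)] by (simp add: power_le_one)
  then have "T x s = (Cb x + sqrt (1 - (H x)\<^sup>2) * s)\<^sup>2 + (H x * s)\<^sup>2"
    unfolding T_def by algebra
  moreover have "(H x * s)\<^sup>2 > 0" using H_pos[OF assms(1)] assms(2) by simp
  ultimately show ?thesis by (simp add: add_nonneg_pos)
qed

text \<open>Otherwise \<open>F\<close> is a multiple of \<open>q\<^sub>t\<close>, so that \<open>F\<^sup>2\<close> is constant in the direction of the unit vector.\<close>

lemma Cb_nz: assumes x: "x \<in> U" shows "Cb x \<noteq> 0"
proof
  assume Cb: "Cb x = 0"
  interpret fs_fiber a \<beta> x F "Dx x" "Ix x" "\<Phi> x" by (rule fiber[OF x])
  obtain s where "s \<in> Ix x" using connected_Ix(2)[OF x] by blast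
  then obtain y where y: "y \<in> Dx x" by (auto simp: I_eq)
  note s = u_in_I[OF y]
  have 1: "deriv (\<Phi> x) s = \<Phi> x s * (1 / s)" if "s \<in> Ix x" for s
    using tau[OF that] tau_eq[OF that] Ix_props(2)[OF that]
    by (cases "deriv (\<Phi> x) s = 0") (auto simp: Cb field_simps power2_eq_square)
  have "((\<lambda>s. \<Phi> x s * (1 / s)) has_real_derivative
      \<Phi> x (u y) * (- 1 / (u y)\<^sup>2) + deriv (\<Phi> x) (u y) * (1 / u y)) (at (u y))"
  proof -
    have "((\<lambda>s. 1 / s) has_real_derivative - 1 / (u y)\<^sup>2) (at (u y))"
      using Ix_props(2)[OF s] DERIV_inverse[of "u y"] by (simp add: inverse_eq_divide power2_eq_square)
    then show ?thesis
      by (rule DERIV_mult'[OF smooth_on_real_has_deriv[OF smooth_\<Phi> s]])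
  qed
  then have "(deriv (\<Phi> x) has_real_derivative
      \<Phi> x (u y) * (- 1 / (u y)\<^sup>2) + deriv (\<Phi> x) (u y) * (1 / u y)) (at (u y))"
    by (rule has_field_derivative_transform_within_open[OF _ open_I s]) (simp add: 1)
  from DERIV_imp_deriv[OF this] have "deriv (deriv (\<Phi> x)) (u y) = 0"
    by (simp add: 1[OF s] power2_eq_square)
  moreover have "dF y e = 0"
    using Ix_props(2)[OF s] by (simp add: dF_def 1[OF s] ip_iv_e)
  ultimately have "e \<bullet> (fundamental_tensor F x y *v e) = 0"
    unfolding tensor_F_e[OF y] by simp
  moreover have "e \<noteq> 0" using b_e fs_point.c_pos[OF point[OF x]] by (metis b.zero less_irrefl)
  ultimately show False using F_props(2)[of x y e] y by (simp add: Dx_D)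
qed

lemma tau_W:
  assumes "w \<in> Wx x" shows "tau V x w = T x (ups x w)"
  using tau[OF W_props(4)[OF assms]] by (simp add: W_props(5)[OF assms] T_def)

lemma deriv_tau:
  assumes w: "w \<in> Wx x"
  shows "deriv (tau V x) w = (2 * Cb x * sqrt (1 - (H x)\<^sup>2) + 2 * ups x w) * (w / ups x w)"
proof -
  have p: "w\<^sup>2 + 1 - 1 / (c_norm a \<beta> x)\<^sup>2 > 0"
    using W_props(3,6)[OF w] by (metis zero_less_power)
  have "((\<lambda>w. w\<^sup>2 + 1 - k) has_real_derivative 2 * w) (at w)" for k
    by (auto intro!: derivative_eq_intros)
  from DERIV_chain2[where f = sqrt and x = w, OF DERIV_real_sqrt[OF p] this]
  have "(ups x has_real_derivative inverse (ups x w) / 2 * (2 * w)) (at w)"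
    unfolding ups_def[abs_def] .
  then have u: "(ups x has_real_derivative w / ups x w) (at w)"
    by (simp add: inverse_eq_divide)
  have "(T x has_real_derivative 2 * Cb x * sqrt (1 - (H x)\<^sup>2) + 2 * s) (at s)" for s
  proof -
    have "((\<lambda>s. k + l * s + s\<^sup>2) has_real_derivative l + 2 * s) (at s)" for k l :: real
      by (auto intro!: derivative_eq_intros)
    then show ?thesis unfolding T_def[abs_def] .
  qed
  from DERIV_chain2[where f = "T x" and g = "ups x" and x = w, OF this u]
  have "(tau V x has_real_derivative
      (2 * Cb x * sqrt (1 - (H x)\<^sup>2) + 2 * ups x w) * (w / ups x w)) (at w)"
    by (rule has_field_derivative_transform_within_open[OF _ open_Wx w]) (simp add: tau_W)
  then show ?thesis by (rule DERIV_imp_deriv)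
qed

lemma Q_eq: assumes w: "w \<in> Wx x" shows "Q x w = (Cb x)\<^sup>2"
  and X_eq: "H x * ups x w * X x w = \<bar>Cb x\<bar> + sgn (Cb x) * sqrt (1 - (H x)\<^sup>2) * ups x w"
proof -
  define R where "R = sqrt (1 - (H x)\<^sup>2)"
  note p = W_props(2,3)[OF w] and x = W_props(1)[OF w]
  \<comment> \<open>Since du/dw = w/u, the left side is u times the derivative of \<tau> with
    respect to u.\<close>
  have d: "(ups x w)\<^sup>2 * deriv (tau V x) w / w = 2 * Cb x * R * ups x w + 2 * (ups x w)\<^sup>2"
    unfolding deriv_tau[OF w] R_def[symmetric] using p by (simp add: power2_eq_square field_simps)
  show Q: "Q x w = (Cb x)\<^sup>2"
    unfolding Q_def d tau_W[OF w] T_def R_def[symmetric] by simp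
  have "(ups x w)\<^sup>2 * deriv (tau V x) w / (2 * w) = Cb x * R * ups x w + (ups x w)\<^sup>2"
    using d by (simp add: field_simps)
  then have "tau V x w - (ups x w)\<^sup>2 * deriv (tau V x) w / (2 * w) = (Cb x)\<^sup>2 + Cb x * R * ups x w"
    unfolding tau_W[OF w] T_def R_def[symmetric] by simp
  then have "H x * ups x w * X x w = ((Cb x)\<^sup>2 + Cb x * R * ups x w) / \<bar>Cb x\<bar>"
    unfolding X_def Q using p H_pos[OF x] by simp
  also have "\<dots> = \<bar>Cb x\<bar> + sgn (Cb x) * R * ups x w"
    using Cb_nz[OF x] by (auto simp: sgn_if abs_if power2_eq_square field_simps)
  finally show "H x * ups x w * X x w = \<bar>Cb x\<bar> + sgn (Cb x) * sqrt (1 - (H x)\<^sup>2) * ups x w"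
    unfolding R_def .
qed

lemma W_U: "p \<in> W \<Longrightarrow> fst p \<in> U"
  using W_props(1) W_Wx by blast

lemma smooth_tau: "smooth_on (\<lambda>(x, w). tau V x w) W"
proof -
  \<comment> \<open>By the convention for division, a zero of this derivative would force \<tau> =
    0, against \<open>T_pos\<close>.\<close>
  have "deriv (V (fst p)) (snd p) \<noteq> 0" if "p \<in> W" for p
  proof
    assume "deriv (V (fst p)) (snd p) = 0"
    then have "tau V (fst p) (snd p) = 0" by (simp add: tau_def)
    moreover have "tau V (fst p) (snd p) > 0"
      using that W_Wx tau_W T_pos W_props(1,3) by metis
    ultimately show False by simp
  qed
  moreover have "smooth_on (\<lambda>p. V (fst p) (snd p)) W" "smooth_on (\<lambda>p. deriv (V (fst p)) (snd p)) W"
    using smooth_V smooth_on_partial_deriv[OF open_W smooth_V] by (simp_all add: case_prod_beta')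
  ultimately show ?thesis
    unfolding tau_def case_prod_beta'
    by (intro smooth_on_divide smooth_on_mult smooth_on_snd open_W)
qed

lemma smooth_ups2: "smooth_on (\<lambda>p. (snd p)\<^sup>2 + 1 - 1 / (c_norm a \<beta> (fst p))\<^sup>2) W"
  by (intro smooth_on_diff smooth_on_add smooth_on_power2 smooth_on_snd smooth_on_const open_W
      smooth_base[OF smooth_inverse_c2] W_U)

lemma ups2: "p \<in> W \<Longrightarrow> (ups (fst p) (snd p))\<^sup>2 = (snd p)\<^sup>2 + 1 - 1 / (c_norm a \<beta> (fst p))\<^sup>2"
  using W_props(6) W_Wx by blast

lemma smooth_ups: "smooth_on (\<lambda>p. ups (fst p) (snd p)) W"
proof -
  have "(snd p)\<^sup>2 + 1 - 1 / (c_norm a \<beta> (fst p))\<^sup>2 > 0" if "p \<in> W" for p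
    unfolding ups2[OF that, symmetric] using that W_Wx W_props(3) by (metis zero_less_power)
  then show ?thesis
    unfolding ups_def by (intro smooth_on_sqrt open_W smooth_ups2)
qed

text \<open>\<open>Cb\<close> is used pointwise, to see that Q is positive; the root and the
  quotient in X are then smooth jointly in both variables.\<close>

lemma smooth_angle: "smooth_on (\<lambda>(x, w). angle x w) W"
proof -
  have nz: "snd p \<noteq> 0" "2 * snd p \<noteq> 0" "Q (fst p) (snd p) > 0"
    "H (fst p) \<noteq> 0" "H (fst p) * ups (fst p) (snd p) * sqrt (Q (fst p) (snd p)) \<noteq> 0" if "p \<in> W" for p
  proof -
    have w: "snd p \<in> Wx (fst p)" using that W_Wx by blast
    note p = W_props(1-3)[OF w]
    show "Q (fst p) (snd p) > 0" unfolding Q_eq[OF w] using Cb_nz[OF p(1)] by simp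
    then show "snd p \<noteq> 0" "2 * snd p \<noteq> 0"
      "H (fst p) \<noteq> 0" "H (fst p) * ups (fst p) (snd p) * sqrt (Q (fst p) (snd p)) \<noteq> 0"
      using p H_pos[OF p(1)] by auto
  qed
  have t: "smooth_on (\<lambda>p. tau V (fst p) (snd p)) W" "smooth_on (\<lambda>p. deriv (tau V (fst p)) (snd p)) W"
    using smooth_tau smooth_on_partial_deriv[OF open_W smooth_tau] by (simp_all add: case_prod_beta')
  have h: "smooth_on (\<lambda>p. H (fst p)) W" "smooth_on (\<lambda>p. C (fst p)) W" "smooth_on (\<lambda>p. C1 (fst p)) W"
    by (rule smooth_base[OF smooth_H open_W], erule W_U, rule smooth_base[OF smooth_C open_W], erule W_U,
      rule smooth_base[OF smooth_C1 open_W], erule W_U)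
  have Q: "smooth_on (\<lambda>p. Q (fst p) (snd p)) W"
    unfolding Q_def
    by (intro smooth_on_diff smooth_on_add smooth_on_divide smooth_on_mult smooth_on_power2 smooth_on_snd open_W
      t smooth_ups nz(1))
  have X: "smooth_on (\<lambda>p. X (fst p) (snd p)) W"
    unfolding X_def
    by (intro smooth_on_diff smooth_on_divide smooth_on_mult smooth_on_power2 smooth_on_snd open_W
      t h smooth_ups smooth_on_const smooth_on_sqrt Q nz)
  have "1 + (X (fst p) (snd p))\<^sup>2 > 0" for p
    by (simp add: add_pos_nonneg)
  then show ?thesis
    unfolding angle_def case_prod_beta'
    by (intro smooth_on_diff smooth_on_arctan smooth_on_divide smooth_on_mult smooth_on_sqrt smooth_on_add smooth_on_power2
      smooth_on_const open_W h X nz(4))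
qed

text \<open>By \<open>conformal_angle\<close> the Moebius image of \<open>angle\<close> has sine 1/S
  and cosine X/S with S = sqrt(1 + X^2), the form that \<open>conformal_of_tau\<close> asks
  for.\<close>

lemma tensor_angle:
  assumes y: "y \<in> Dx x"
  defines "J \<equiv> jacobian (t_map a \<beta> V C C1 angle x) (at y)"
  shows "fundamental_tensor F x y $ m $ n = (1 / H x * F x y powr (1 - H x))\<^sup>2 *
      (\<Sum>i\<in>UNIV. \<Sum>j\<in>UNIV. a x $ i $ j * J $ i $ m * J $ j $ n)"
proof -
  note x = Dx_props(1)[OF y]
  interpret fs_fiber a \<beta> x F "Dx x" "Ix x" "\<Phi> x" by (rule fiber[OF x])
  have ups: "ups x (om x s) = s" if "s \<in> Ix x" for s
    using Ix_props(6)[OF that] by (simp add: ups_def)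
  have \<sigma>: "\<sigma> angle x s = 1 / sqrt (1 + (X x (om x s))\<^sup>2)" for s
    unfolding \<sigma>_def angle_def H_deg_def by (rule conformal_angle(1)[OF C_gt[OF x]])
  have \<kappa>: "\<kappa> angle x s = X x (om x s) / sqrt (1 + (X x (om x s))\<^sup>2)" for s
    unfolding \<kappa>_def angle_def H_deg_def by (rule conformal_angle(2)[OF C_gt[OF x]])
  have X: "H x * s * X x (om x s) = \<bar>Cb x\<bar> + sgn (Cb x) * sqrt (1 - (H x)\<^sup>2) * s" if "s \<in> Ix x" for s
    using X_eq[OF Ix_props(3)[OF that]] by (simp add: ups[OF that])
  have t: "s * \<Phi> x s / deriv (\<Phi> x) s = (Cb x)\<^sup>2 + 2 * Cb x * sqrt (1 - (H x)\<^sup>2) * s + s\<^sup>2" if "s \<in> Ix x" for s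
    using tau[OF that] tau_eq[OF that] by simp
  have "(H x)\<^sup>2 * (u y * deriv (\<Phi> x) (u y)) = \<Phi> x (u y) * (\<sigma> angle x (u y))\<^sup>2"
    by (rule conformal_of_tau(1)[where I = "Ix x" and X = "\<lambda>s. X x (om x s)" and \<kappa> = "\<kappa> angle x" and C = "Cb x"],
      rule open_I, rule u_in_I[OF y], erule Ix_props(2), rule smooth_\<Phi>, erule \<Phi>_pos, rule H_pos[OF x],
      rule H_le[OF x], erule t, rule Cb_nz[OF x], erule X, rule \<sigma>, rule \<kappa>)
  moreover have "(H x)\<^sup>2 * deriv (deriv (\<Phi> x)) (u y) =
      \<Phi> x (u y) * ((deriv (\<sigma> angle x) (u y))\<^sup>2 + (deriv (\<kappa> angle x) (u y))\<^sup>2)"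
    by (rule conformal_of_tau(2)[where I = "Ix x" and X = "\<lambda>s. X x (om x s)" and C = "Cb x"],
      rule open_I, rule u_in_I[OF y], erule Ix_props(2), rule smooth_\<Phi>, erule \<Phi>_pos, rule H_pos[OF x],
      rule H_le[OF x], erule t, rule Cb_nz[OF x], erule X, rule \<sigma>, rule \<kappa>)
  ultimately show ?thesis
    using tensor_iff[OF y smooth_angle] unfolding J_def by blast
qed

text \<open>Read off from the Moebius form in \<open>t_map_eq\<close>, whose denominator C + C1 cos
  r is positive.\<close>

lemma smooth_t: "smooth_on (\<lambda>(x, y). t_map a \<beta> V C C1 angle x y) D"
proof (rule smooth_on_cong[OF open_D])
  let ?r = "\<lambda>p. angle (fst p) (w_fun a \<beta> (fst p) (snd p))"
  let ?d = "\<lambda>p. C (fst p) + C1 (fst p) * cos (?r p)"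
  let ?t = "\<lambda>p. (F (fst p) (snd p) powr H (fst p)) *\<^sub>R
    ((H (fst p) * sin (?r p) / ?d p) *\<^sub>R i_vec a \<beta> (fst p) (snd p)
      + ((C1 (fst p) + C (fst p) * cos (?r p)) / ?d p) *\<^sub>R b_up_unit a \<beta> (fst p))"
  have h: "smooth_on (\<lambda>p. H (fst p)) D" "smooth_on (\<lambda>p. C (fst p)) D" "smooth_on (\<lambda>p. C1 (fst p)) D"
      "smooth_on (\<lambda>p. b_up_unit a \<beta> (fst p)) D"
    by (rule smooth_base[OF smooth_H open_D], erule M_D(3), rule smooth_base[OF smooth_C open_D], erule M_D(3),
      rule smooth_base[OF smooth_C1 open_D], erule M_D(3), rule smooth_base[OF smooth_e open_D], erule M_D(3))
  have r: "smooth_on ?r D" by (rule smooth_on_w_comp[OF smooth_angle])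
  have nz: "?d p \<noteq> 0" "F (fst p) (snd p) > 0" if "p \<in> D" for p
    using denominator_pos[OF M_D(3)[OF that], of "?r p"] F_props(1)[of "fst p" "snd p"] that by auto
  have F: "smooth_on (\<lambda>p. F (fst p) (snd p)) D" using smooth_F by (simp add: case_prod_beta')
  show "smooth_on ?t D"
    by (intro smooth_on_scaleR smooth_on_powr smooth_on_add smooth_on_divide smooth_on_mult
      smooth_on_sin smooth_on_cos open_D h r F nz smooth_on_subset[OF smooth_i_vec M_D(2)])
  show "?t p = (case p of (x, y) \<Rightarrow> t_map a \<beta> V C C1 angle x y)" if "p \<in> D" for p
    using t_map_eq[where C = C and ?C1.0 = C1 and x = "fst p" and y = "snd p" and \<rho> = angle and a = a and \<beta> = \<beta> and V = V,
        OF C_gt[OF M_D(3)[OF that]] refl]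
    by (simp add: case_prod_beta')
qed

text \<open>Conformality to a positive definite tensor makes the derivative injective, so the
  inverse function theorem applies.\<close>

lemma locally_invertible_t: "locally_invertible_on (t_map a \<beta> V C C1 angle x) (Dx x)"
proof (rule locally_invertible_on_inj_derivative[OF open_Dx])
  show s: "smooth_on (t_map a \<beta> V C C1 angle x) (Dx x)"
    unfolding Dx_def by (rule smooth_on_slice[OF open_D smooth_t])
  fix y assume y: "y \<in> Dx x"
  interpret fs_fiber a \<beta> x F "Dx x" "Ix x" "\<Phi> x" by (rule fiber[OF Dx_props(1)[OF y]])
  show "inj (frechet_derivative (t_map a \<beta> V C C1 angle x) (at y))"
    by (rule conformal_deriv_inj[OF smooth_on_has_derivative[OF s y] tensor_angle[OF y]])
      (use F_props(2) y in \<open>auto simp: Dx_D\<close>)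
qed

text \<open>The variable w and the vector i are invariant under scaling, so only the factor F^H
  scales.\<close>

lemma t_scale:
  assumes y: "y \<in> Dx x" and k: "k > 0"
  shows "t_map a \<beta> V C C1 \<rho> x (k *\<^sub>R y) = (k powr H x) *\<^sub>R t_map a \<beta> V C C1 \<rho> x y"
proof -
  note x = Dx_props(1)[OF y]
  interpret fs_point a \<beta> x by (rule point[OF x])
  have "F x (k *\<^sub>R y) powr H x = k powr H x * F x y powr H x"
    using F_props[of x y] y k by (simp add: Dx_D powr_mult)
  then show ?thesis
    by (simp add: t_map_def Let_def wv_scale[OF k] iv_scale[OF k])
qed

text \<open>i and the unit vector along \<open>B\<close> are orthonormal, and (\<sigma>, \<kappa>)
  lies on the unit circle.\<close>

lemma norm_t:
  assumes y: "y \<in> Dx x"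
  shows "riem_norm a x (t_map a \<beta> V C C1 \<rho> x y) = F x y powr H x"
proof -
  note x = Dx_props(1)[OF y]
  interpret fs_point a \<beta> x by (rule point[OF x])
  let ?v = "\<sigma> \<rho> x (u y) *\<^sub>R iv y + \<kappa> \<rho> x (u y) *\<^sub>R e"
  have "ip ?v ?v = (\<sigma> \<rho> x (u y))\<^sup>2 + (\<kappa> \<rho> x (u y))\<^sup>2"
    by (simp add: ip.add_left ip.add_right ip.scaleR_left ip.scaleR_right ip_iv_iv[OF Dx_props(3)[OF y]]
        ip_e_e ip_iv_e ip_flip power2_eq_square)
  then have "ip ?v ?v = 1" using unit[OF x] by simp
  then show ?thesis
    unfolding t_fiber[OF y] riem_norm_def ip_def[symmetric]
    by (simp add: ip.scaleR_left ip.scaleR_right power2_eq_square[symmetric])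
qed

lemma conformal_automorphism_angle: "conformal_automorphism D a F H (t_map a \<beta> V C C1 angle)"
proof -
  \<comment> \<open>With \<open>norm_t\<close> this matches the two unit spheres; it rests on H >
    0.\<close>
  have "F x y powr H x = 1 \<longleftrightarrow> F x y = 1" if "y \<in> Dx x" for x y
    using F_props(1)[of x y] H_pos[OF Dx_props(1)[OF that]] that by (simp add: Dx_D powr_def)
  then show ?thesis
    unfolding conformal_automorphism_def Let_def
    using smooth_t locally_invertible_t t_scale norm_t tensor_angle
    by (auto simp: Dx_D Dx_def[symmetric])
qed

end

end

section \<open>Equivalence of conformality and the quadratic for \<tau>\<close>

theorem proposition5p3:
  fixes U :: "(real^'n) set"
    and a :: "real^'n \<Rightarrow> real^'n^'n"
    and \<beta> :: "real^'n \<Rightarrow> real^'n"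
    and W :: "((real^'n) \<times> real) set"
    and V :: "real^'n \<Rightarrow> real \<Rightarrow> real"
    and C C1 :: "real^'n \<Rightarrow> real"
  assumes "CARD('n) \<ge> 3"
    and "fs_space U a \<beta> W V"
    and "smooth_on C U" and "smooth_on C1 U"
    and "\<forall>x\<in>U. C x > 0 \<and> C x > \<bar>C1 x\<bar>"
  shows
    "(\<exists>\<rho> :: real^'n \<Rightarrow> real \<Rightarrow> real.
        smooth_on (\<lambda>(x, w). \<rho> x w) W \<and>
        (\<forall>(x, w)\<in>W. 0 < \<rho> x w \<and> \<rho> x w < pi) \<and>
        conformal_automorphism (fs_domain U a \<beta> W) a (fs_metric a \<beta> V) (H_deg C C1)
          (t_map a \<beta> V C C1 \<rho>))
     \<longleftrightarrow>
     (\<forall>x\<in>U. H_deg C C1 x \<le> 1) \<and>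
     (\<exists>Cb :: real^'n \<Rightarrow> real. \<forall>(x, y)\<in>fs_domain U a \<beta> W.
        tau V x (w_fun a \<beta> x y) =
          (Cb x)\<^sup>2 + 2 * Cb x * sqrt (1 - (H_deg C C1 x)\<^sup>2) * wt_fun a \<beta> x y + (wt_fun a \<beta> x y)\<^sup>2)"
    (is "?L \<longleftrightarrow> ?R1 \<and> ?R2")
proof -
  interpret fs_conformal U a \<beta> W V C C1
    using assms by unfold_locales auto
  show ?thesis
  proof
    assume ?L
    then obtain \<rho> where \<rho>: "smooth_on (\<lambda>(x, w). \<rho> x w) W" "\<forall>(x, w)\<in>W. 0 < \<rho> x w \<and> \<rho> x w < pi"
      "conformal_automorphism D a F H (t_map a \<beta> V C C1 \<rho>)" by blast
    note 1 = tau_of_conformal_automorphism[OF \<rho>]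
    \<comment> \<open>The scalar is found fiber by fiber and then collected by choice into a
      function of the base point.\<close>
    from 1(2) have "\<forall>x\<in>U. \<exists>Cb. \<forall>s\<in>Ix x. tau V x (om x s) = Cb\<^sup>2 + 2 * Cb * sqrt (1 - (H x)\<^sup>2) * s + s\<^sup>2"
      by blast
    then obtain Cb where Cb: "\<forall>x\<in>U. \<forall>s\<in>Ix x.
        tau V x (om x s) = (Cb x)\<^sup>2 + 2 * Cb x * sqrt (1 - (H x)\<^sup>2) * s + s\<^sup>2"
      by metis
    have "tau V x (w_fun a \<beta> x y) =
          (Cb x)\<^sup>2 + 2 * Cb x * sqrt (1 - (H x)\<^sup>2) * wt_fun a \<beta> x y + (wt_fun a \<beta> x y)\<^sup>2"
      if "(x, y) \<in> D" for x y
    proof -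
      have y: "y \<in> Dx x" using that by (simp add: Dx_D)
      then have "wt_fun a \<beta> x y \<in> Ix x" by (simp add: Ix_def)
      then show ?thesis using Cb Dx_props(1,5)[OF y] by fastforce
    qed
    then show "?R1 \<and> ?R2" using 1(1) by blast
  next
    assume R: "?R1 \<and> ?R2"
    then obtain Cb where Cb: "\<And>x y. (x, y) \<in> D \<Longrightarrow> tau V x (w_fun a \<beta> x y) =
          (Cb x)\<^sup>2 + 2 * Cb x * sqrt (1 - (H x)\<^sup>2) * wt_fun a \<beta> x y + (wt_fun a \<beta> x y)\<^sup>2"
      by blast
    have tau: "tau V x (om x s) = (Cb x)\<^sup>2 + 2 * Cb x * sqrt (1 - (H x)\<^sup>2) * s + s\<^sup>2" if "s \<in> Ix x" for x s
    proof -
      obtain y where y: "y \<in> Dx x" "s = wt_fun a \<beta> x y" using \<open>s \<in> Ix x\<close> by (auto simp: Ix_def)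
      then show ?thesis using Cb[of x y] Dx_props(5)[OF y(1)] by (simp add: Dx_D)
    qed
    have H_le: "H x \<le> 1" if "x \<in> U" for x using R that by blast
    \<comment> \<open>The witness \<open>angle\<close> is an explicit expression in \<tau>,
      \<open>C\<close> and \<open>C1\<close>; \<open>Cb\<close> serves to verify its
      properties.\<close>
    have "smooth_on (\<lambda>(x, w). angle x w) W"
      by (rule smooth_angle[where Cb = Cb], erule H_le, erule tau)
    moreover have "0 < angle x w \<and> angle x w < pi" for x w
      by (simp add: angle_bounds)
    moreover have "conformal_automorphism D a F H (t_map a \<beta> V C C1 angle)"
      by (rule conformal_automorphism_angle[where Cb = Cb], erule H_le, erule tau)
    ultimately show ?L by blast
  qed
qed

end
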